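(* Let $A$ be a degenerate-resonant graph. Then $A$ is not allowable; hence, for generic $S=\{v_1,\dots,v_m\}\subset\mathbb R^n$, $A$ has no geometric realizations outside the special component, that is, there is no $x\in\mathbb R^n\setminus S$ such that for every $h=(a,\sigma)\in A$ $$(x,\pi(a))=K(h)\ \text{ if }\sigma=1,\qquad |x|^2+(x,\pi(a))=K(h)\ \text{ if }\sigma=-1.$$
   Context: $e_1,\dots,e_m$ is the standard basis of $\mathbb Z^m$; $\eta:\mathbb Z^m\to\mathbb Z$ is linear with $\eta(e_i)=1$. $G=\mathbb Z^m\rtimes\mathbb Z/(2)$ consists of elements $a=(a,+)$ (black) and $a\tau=(a,-)$ (red), $a\in\mathbb Z^m$, with $\tau^2=1$, $\tau a=(-a)\tau$. Let $X=\{e_i-e_j: i\ne j\}\cup\{(-e_i-e_j)\tau: i\neq j\}$; it generates the subgroup $G_{-2}=\{a:\eta(a)=0\}\cup\{a\tau:\eta(a)=-2\}$. In the Cayley graph $G_X$, $u,v$ are joined by an edge marked $x\in X$ when $v=xu$. A graph $A$ here is a finite connected complete (i.e. induced) subgraph of $G_X$ contained in $G_{-2}$ and containing $0$. Dropping the sign, its vertices are identified with elements of $\mathbb Z^m$ of mass $\eta(a)=0$ (black) or $\eta(a)=-2$ (red). $A$ is degenerate if the dimension of the affine space spanned by its vertices in $\mathbb R^m$ is strictly less than (number of vertices) $-1$. For $a=\sum a_ie_i$ let $a^{(2)}=\sum_i a_ie_i^2$, a quadratic polynomial in the commuting variables $e_i$, and $C(a)=\frac12(a^2+a^{(2)})$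 if $a$ is black, $C(a)=-\frac12(a^2+a^{(2)})$ if $a$ is red. $A$ is degenerate-resonant if it is degenerate and for every integral linear relation $\sum_i n_ia_i=0$ among its vertices one has also $\sum_i n_iC(a_i)=0$. A connected graph is not allowable if it contains vertices $a\in\mathbb Z^m$ (black) and $b\tau$, $b\in\mathbb Z^m$ (red), with $a+b=-2e_i$ or $a+b=-3e_i+e_j$ for some indices $i\neq j$; otherwise it is allowable. Given $S=\{v_1,\dots,v_m\}\subset\mathbb R^n$: $\pi(e_i)=v_i$, extended linearly, and $K((a,\sigma))=\frac{\sigma}{2}(|\sum a_iv_i|^2+\sum a_i|v_i|^2)$. Generic: whenever $P(v_1,\dots,v_m)\neq0$ for a suitable nonzero real polynomial $P$ in the coordinates of the $v_i$. (The displayed equations express that the points $hx$, $h\in A$, where $ax=x-\pi(a)$ and $\tau x=-x$, are vertices of a component, with root $x$, of the graph on $\mathbb R^n$ whose black edges join $p,q=p+v_j-v_i$ with $(p-v_i,v_i-v_j)=0$ and whose red edges join $p,q=v_i+v_j-p$ with $(p-v_i,p-v_j)=0$; the special component of that graph is $S$.) *)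

theory Defs
  imports "HOL-Analysis.Analysis" "HOL-Algebra.Group" "HOL-Library.Poly_Mapping"
begin

text \<open>
  The index type \<open>'m\<close> plays the role of \<open>{1, \<dots>, m}\<close>. The element \<open>a\<close> of \<open>G\<close> is
  \<open>(a, Black)\<close> and \<open>a\<tau>\<close> is \<open>(a, Red)\<close>.
\<close>

datatype colour = Black | Red

type_synonym 'm elt = "(int ^ 'm) \<times> colour"

fun sign :: "colour \<Rightarrow> 'a::ring_1" where
  "sign Black = 1"
| "sign Red = - 1"

definition G :: "('m::finite) elt monoid" where
  "G = \<lparr> carrier = UNIV,
         mult = (\<lambda>(a, s) (b, t). (a + sign s *s b, if s = t then Black else Red)),
         one = (0, Black) \<rparr>"

definition e :: "'m::finite \<Rightarrow> int ^ 'm" where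
  "e i = axis i 1"

definition \<eta> :: "int ^ ('m::finite) \<Rightarrow> int" where
  "\<eta> a = (\<Sum>i\<in>UNIV. a $ i)"

definition X :: "('m::finite) elt set" where
  "X = {(e i - e j, Black) | i j. i \<noteq> j} \<union> {(- e i - e j, Red) | i j. i \<noteq> j}"

definition G_minus_2 :: "('m::finite) elt set" where
  "G_minus_2 = {(a, Black) | a. \<eta> a = 0} \<union> {(a, Red) | a. \<eta> a = - 2}"

definition adjacent :: "('m::finite) elt \<Rightarrow> 'm elt \<Rightarrow> bool" where
  "adjacent u v \<longleftrightarrow> (\<exists>x\<in>X. v = x \<otimes>\<^bsub>G\<^esub> u)"

lemma group_G: "group G"
proof (rule groupI)
  fix x y z :: "('m::finite) elt"
  show "x \<otimes>\<^bsub>G\<^esub> y \<otimes>\<^bsub>G\<^esub> z = x \<otimes>\<^bsub>G\<^esub> (y \<otimes>\<^bsub>G\<^esub> z)"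
    by (cases x; cases y; cases z; cases "snd x"; cases "snd y"; cases "snd z")
      (auto simp: G_def vec_eq_iff)
next
  fix x :: "('m::finite) elt"
  obtain a s where x: "x = (a, s)" by force
  show "\<exists>y\<in>carrier G. y \<otimes>\<^bsub>G\<^esub> x = \<one>\<^bsub>G\<^esub>"
    by (rule bexI[of _ "(- (sign s *s a), s)"]) (cases s; auto simp: G_def x vec_eq_iff)+
next
  fix x :: "('m::finite) elt"
  show "\<one>\<^bsub>G\<^esub> \<otimes>\<^bsub>G\<^esub> x = x"
    by (cases x; cases "snd x") (auto simp: G_def vec_eq_iff)
qed (auto simp: G_def)

text \<open>\<open>X\<close> is closed under inverses, so the Cayley graph is undirected.\<close>

lemma adjacent_sym: "adjacent u v \<Longrightarrow> adjacent v u"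
proof -
  assume "adjacent u v"
  then obtain x where x: "x \<in> X" "v = x \<otimes>\<^bsub>G\<^esub> u" by (auto simp: adjacent_def)
  obtain a s where u: "u = (a, s)" by force
  from x(1) consider i j where "i \<noteq> j" "x = (e i - e j, Black)"
    | i j where "i \<noteq> j" "x = (- e i - e j, Red)" by (auto simp: X_def)
  then show ?thesis
  proof cases
    case 1
    have "(e j - e i, Black) \<in> X" using 1 by (auto simp: X_def)
    moreover have "u = (e j - e i, Black) \<otimes>\<^bsub>G\<^esub> v"
      using 1 x(2) u by (cases s) (auto simp: G_def vec_eq_iff)
    ultimately show ?thesis by (auto simp: adjacent_def)
  next
    case 2
    have "u = x \<otimes>\<^bsub>G\<^esub> v"
      using 2 x(2) u by (cases s) (auto simp: G_def vec_eq_iff)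
    then show ?thesis using x(1) by (auto simp: adjacent_def)
  qed
qed

text \<open>A complete (induced) subgraph is given by its vertex set.\<close>

definition is_graph :: "('m::finite) elt set \<Rightarrow> bool" where
  "is_graph A \<longleftrightarrow> finite A \<and> A \<subseteq> G_minus_2 \<and> (0, Black) \<in> A \<and>
     (\<forall>u\<in>A. \<forall>v\<in>A. (u, v) \<in> {(p, q). p \<in> A \<and> q \<in> A \<and> adjacent p q}\<^sup>*)"

text \<open>
  Dropping the colour is injective on \<open>G_minus_2\<close>, since the mass \<open>\<eta>\<close> determines it, so
  \<open>card A\<close> is also the number of vertices seen in \<open>\<real>\<^sup>m\<close>.
\<close>

definition degenerate :: "('m::finite) elt set \<Rightarrow> bool" where
  "degenerate A \<longleftrightarrow>
     aff_dim ((\<lambda>h. (\<chi> i. real_of_int (fst h $ i)) :: real ^ 'm) ` A) < int (card A) - 1"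

text \<open>
  Polynomials in commuting variables indexed by \<open>'m\<close>: finitely supported families of rational
  coefficients over the monomials \<open>'m \<Rightarrow>\<^sub>0 nat\<close>.
\<close>

type_synonym 'm polynomial = "('m \<Rightarrow>\<^sub>0 nat) \<Rightarrow>\<^sub>0 rat"

definition Var :: "'m \<Rightarrow> 'm polynomial" where
  "Var i = Poly_Mapping.single (Poly_Mapping.single i 1) 1"

definition Const :: "rat \<Rightarrow> 'm polynomial" where
  "Const c = Poly_Mapping.single 0 c"

definition linear_form :: "int ^ ('m::finite) \<Rightarrow> 'm polynomial" where
  "linear_form a = (\<Sum>i\<in>UNIV. of_int (a $ i) * Var i)"

definition sum_squares :: "int ^ ('m::finite) \<Rightarrow> 'm polynomial" where
  "sum_squares a = (\<Sum>i\<in>UNIV. of_int (a $ i) * (Var i)\<^sup>2)"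

fun C :: "('m::finite) elt \<Rightarrow> 'm polynomial" where
  "C (a, s) = Const (sign s / 2) * ((linear_form a)\<^sup>2 + sum_squares a)"

definition degenerate_resonant :: "('m::finite) elt set \<Rightarrow> bool" where
  "degenerate_resonant A \<longleftrightarrow> degenerate A \<and>
     (\<forall>n :: 'm elt \<Rightarrow> int. (\<Sum>h\<in>A. n h *s fst h) = 0 \<longrightarrow> (\<Sum>h\<in>A. of_int (n h) * C h) = 0)"

definition allowable :: "('m::finite) elt set \<Rightarrow> bool" where
  "allowable A \<longleftrightarrow> \<not> (\<exists>a b. (a, Black) \<in> A \<and> (b, Red) \<in> A \<and>
     ((\<exists>i. a + b = (- 2) *s e i) \<or> (\<exists>i j. i \<noteq> j \<and> a + b = (- 3) *s e i + e j)))"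

text \<open>The configuration \<open>v\<^sub>1, \<dots>, v\<^sub>m\<close> in \<open>\<real>\<^sup>n\<close> is one vector \<open>v\<close>, with \<open>v $ i\<close> in \<open>\<real>\<^sup>n\<close>.\<close>

definition \<pi> :: "real ^ 'n ^ 'm \<Rightarrow> int ^ ('m::finite) \<Rightarrow> real ^ ('n::finite)" where
  "\<pi> v a = (\<Sum>i\<in>UNIV. of_int (a $ i) *\<^sub>R v $ i)"

fun K :: "real ^ 'n ^ 'm \<Rightarrow> ('m::finite) elt \<Rightarrow> real" where
  "K v (a, s) = sign s / 2 *
     ((norm (\<pi> v a))\<^sup>2 + (\<Sum>i\<in>UNIV. of_int (a $ i) * (norm (v $ i))\<^sup>2))"

definition geometric_realization ::
    "real ^ 'n ^ 'm \<Rightarrow> ('m::finite) elt set \<Rightarrow> real ^ ('n::finite) \<Rightarrow> bool" where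
  "geometric_realization v A x \<longleftrightarrow>
     (\<forall>a. (a, Black) \<in> A \<longrightarrow> x \<bullet> \<pi> v a = K v (a, Black)) \<and>
     (\<forall>a. (a, Red) \<in> A \<longrightarrow> (norm x)\<^sup>2 + x \<bullet> \<pi> v a = K v (a, Red))"

text \<open>
  On \<open>real ^ 'n ^ 'm\<close> the polynomial functions are exactly the polynomials in the coordinates \<open>v $ i $ k\<close>,
  and as \<open>\<real>\<close> is infinite a polynomial is nonzero iff its function is not identically zero.
\<close>

definition for_generic :: "(real ^ ('n::finite) ^ ('m::finite) \<Rightarrow> bool) \<Rightarrow> bool" where
  "for_generic Q \<longleftrightarrow> (\<exists>P :: real ^ 'n ^ 'm \<Rightarrow> real.
     real_polynomial_function P \<and> (\<exists>w. P w \<noteq> 0) \<and> (\<forall>v. P v \<noteq> 0 \<longrightarrow> Q v))"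

end

theory Submission
  imports Defs
begin

text \<open>
  Put \<open>P h = \<sigma> a\<close> for \<open>h = (a, \<sigma>)\<close>. Edges of the graph become pairs of points at \<open>\<ell>\<^sup>1\<close>-distance 2,
  and resonance says that the coordinates of the points are orthogonal,
  \<open>\<Sum>\<^sub>h N\<^sub>h P\<^sub>i(h) P\<^sub>j(h) = 0\<close> for \<open>i \<noteq> j\<close>, with respect to every affine relation \<open>N\<close>. Suppose that no
  two points differ by some \<open>2 e\<^sub>i\<close>, and pass to a minimal connected dependent subset; it has only one
  relation \<open>N\<close>, with support \<open>S\<close>, say. Counting the coordinates that vary along a path outside \<open>S\<close>
  shows that \<open>S\<close> is itself connected. With \<open>W\<^sub>k = \<Sum> N P\<^sub>k\<^sup>2\<close> and the form \<open>Q = \<Sum> x\<^sub>k\<^sup>2 / W\<^sub>k\<close> the set \<open>S\<close>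
  is an orthocentric system: \<open>p - q\<close> is orthogonal to \<open>s - t\<close> for distinct \<open>p, q, s, t\<close>, whereas
  the product of \<open>p - c\<close> and \<open>q - c\<close> is \<open>1 / N\<^sub>c\<close>. Hence the supports of two edges of \<open>S\<close> meet in exactly
  one coordinate if the edges are adjacent, and are equal or disjoint otherwise, which is impossible
  for a connected \<open>S\<close>. So there are vertices with \<open>a + b = - 2 e\<^sub>i\<close>. The equations then give
  \<open>x - \<pi>(a) = v\<^sub>i\<close>, and for generic \<open>v\<close> no edge leads from a vertex \<open>v\<^sub>i\<close> to a point outside the special
  component, so this spreads to the root \<open>x\<close>.
\<close>

section \<open>Connected sets\<close>

text \<open>Connectedness through cuts: a property that passes along edges holds on all of
  \<open>B\<close> once it holds somewhere. For symmetric \<open>R\<close> this is connectedness of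
  the induced graph.\<close>

definition linked :: "('a \<Rightarrow> 'a \<Rightarrow> bool) \<Rightarrow> 'a set \<Rightarrow> bool" where
  "linked R B \<longleftrightarrow> (\<forall>U\<subseteq>B. U \<noteq> {} \<longrightarrow> U \<noteq> B \<longrightarrow> (\<exists>u\<in>U. \<exists>v\<in>B - U. R u v))"

lemma linked_edge:
  assumes "linked R B" "U \<subseteq> B" "U \<noteq> {}" "U \<noteq> B"
  obtains u v where "u \<in> U" "v \<in> B - U" "R u v"
  using assms(1)[unfolded linked_def, rule_format, OF assms(2-4)] that by blast

lemma linked_insert:
  assumes B: "linked R B" and R: "symp R" and y: "y \<in> B" "R x y"
  shows "linked R (insert x B)"
  unfolding linked_def
proof (intro allI impI)
  fix U assume U: "U \<subseteq> insert x B" "U \<noteq> {}" "U \<noteq> insert x B"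
  have yx: "R y x" using R y by (auto dest: sympD)
  show "\<exists>u\<in>U. \<exists>v\<in>insert x B - U. R u v"
  proof (cases "U \<inter> B = {} \<or> U \<inter> B = B")
    case True
    then show ?thesis
    proof
      assume "U \<inter> B = {}"
      then have "U = {x}" "y \<notin> U" using U y by auto
      then show ?thesis using y by auto
    next
      assume "U \<inter> B = B"
      then have "x \<notin> U" "y \<in> U" using U y by auto
      then show ?thesis using yx by auto
    qed
  next
    case False
    then obtain u v where "u \<in> U \<inter> B" "v \<in> B - U \<inter> B" "R u v"
      using linked_edge[OF B, of "U \<inter> B"] by blast
    then show ?thesis by blast
  qed
qed

text \<open>A maximal proper connected subset \<open>K\<close> stays connected when a neighbour
  \<open>p\<close> is added, so maximality leaves no point besides \<open>p\<close> outside
  \<open>K\<close>.\<close>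

lemma linked_non_cut_vertex:
  assumes S: "linked R S" "finite S" "symp R" and two: "x \<in> S" "y \<in> S" "x \<noteq> y"
  obtains p c where "p \<in> S" "c \<in> S - {p}" "R p c" "linked R (S - {p})"
proof -
  define F where "F = {K. K \<subset> S \<and> K \<noteq> {} \<and> linked R K}"
  have "{x} \<in> F" using two by (auto simp: F_def linked_def)
  moreover have "finite F" unfolding F_def using S(2) by (auto intro: finite_subset[of _ "Pow S"])
  ultimately obtain K where K: "K \<in> F" and max: "\<And>L. L \<in> F \<Longrightarrow> K \<subseteq> L \<Longrightarrow> K = L"
    using finite_has_maximal[of F] by blast
  then have "K \<subseteq> S" "K \<noteq> {}" "K \<noteq> S" by (auto simp: F_def)
  then obtain c p where cp: "c \<in> K" "p \<in> S - K" "R c p"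
    using linked_edge[OF S(1)] by metis
  have "R p c" using cp S(3) by (auto dest: sympD)
  then have "linked R (insert p K)" using linked_insert[of R K c p] K S(3) cp by (auto simp: F_def)
  moreover have "insert p K \<subseteq> S" using cp K by (auto simp: F_def)
  moreover have "insert p K \<noteq> K" using cp by auto
  ultimately have "insert p K = S" using max[of "insert p K"] by (auto simp: F_def)
  then have "K = S - {p}" using cp by auto
  with cp K \<open>R p c\<close> show ?thesis by (intro that[of p c]) (auto simp: F_def)
qed

lemma linked_walk:
  assumes A: "linked R A" and a: "a \<in> A" and b: "b \<in> A"
  shows "\<exists>q n. q 0 = a \<and> q n = b \<and> (\<forall>l\<le>n. q l \<in> A) \<and> (\<forall>l<n. R (q l) (q (Suc l)))"
proof -
  define W where "W x \<longleftrightarrow> (\<exists>q n. q 0 = a \<and> q n = x \<and> (\<forall>l\<le>n. q l \<in> A) \<and> (\<forall>l<n. R (q l) (q (Suc l))))"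
    for x
  have Wa: "W a" unfolding W_def using a by (intro exI[of _ "\<lambda>_. a"] exI[of _ 0]) auto
  have ext: "W v" if u: "W u" and v: "v \<in> A" "R u v" for u v
  proof -
    obtain q n where q: "q 0 = a" "q n = u" "\<forall>l\<le>n. q l \<in> A" "\<forall>l<n. R (q l) (q (Suc l))"
      using u unfolding W_def by blast
    show ?thesis unfolding W_def
      using q v by (intro exI[of _ "q(Suc n := v)"] exI[of _ "Suc n"]) (auto simp: less_Suc_eq le_Suc_eq)
  qed
  have "{x \<in> A. W x} = A"
  proof (rule ccontr)
    assume "{x \<in> A. W x} \<noteq> A"
    then obtain u v where "u \<in> {x \<in> A. W x}" "v \<in> A - {x \<in> A. W x}" "R u v"
      using linked_edge[OF A, of "{x \<in> A. W x}"] Wa a by blast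
    then show False using ext by blast
  qed
  then show ?thesis using b unfolding W_def by blast
qed

text \<open>A walk of minimal length will do.\<close>

lemma linked_simple_path:
  assumes A: "linked R A" and S: "S1 \<subseteq> A" "S2 \<subseteq> A" "S1 \<noteq> {}" "S2 \<noteq> {}" "S1 \<inter> S2 = {}"
  obtains q :: "nat \<Rightarrow> 'a" and r where "q 0 \<in> S1" "q (Suc r) \<in> S2"
    "\<And>l. l \<le> Suc r \<Longrightarrow> q l \<in> A" "\<And>l. l \<le> r \<Longrightarrow> R (q l) (q (Suc l))"
    "\<And>l. 1 \<le> l \<Longrightarrow> l \<le> r \<Longrightarrow> q l \<notin> S1 \<union> S2" "inj_on q {1..r}"
proof -
  define W where "W n \<longleftrightarrow> (\<exists>q. q 0 \<in> S1 \<and> q n \<in> S2 \<and> (\<forall>l\<le>n. q l \<in> A) \<and> (\<forall>l<n. R (q l) (q (Suc l))))"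
    for n :: nat
  obtain a b where ab: "a \<in> S1" "b \<in> S2" using S by blast
  then have "\<exists>n. W n" using linked_walk[OF A, of a b] S unfolding W_def by blast
  then obtain n where n: "W n" and min: "\<And>k. k < n \<Longrightarrow> \<not> W k"
    using LeastI_ex[of W] not_less_Least[of _ W] by blast
  from n obtain q where q: "q 0 \<in> S1" "q n \<in> S2" "\<And>l. l \<le> n \<Longrightarrow> q l \<in> A"
    "\<And>l. l < n \<Longrightarrow> R (q l) (q (Suc l))" unfolding W_def by blast
  have "n \<noteq> 0" using q S by (metis disjoint_iff)
  then obtain r where r: "n = Suc r" by (cases n) auto
  have int: "q l \<notin> S1 \<union> S2" if l: "1 \<le> l" "l \<le> r" for l
  proof
    assume "q l \<in> S1 \<union> S2"
    then show False
    proof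
      assume "q l \<in> S1"
      \<comment> \<open>Dropping the first \<open>l\<close> steps would give a shorter walk.\<close>
      moreover have "R (q (k + l)) (q (Suc k + l))" if "k < n - l" for k
        using q(4)[of "k + l"] that by simp
      ultimately have "W (n - l)" unfolding W_def using q l r
        by (intro exI[of _ "\<lambda>k. q (k + l)"]) auto
      then show False using min l r by auto
    next
      assume "q l \<in> S2"
      then have "W l" unfolding W_def using q l r by (intro exI[of _ q]) auto
      then show False using min l r by auto
    qed
  qed
  have neq: "q j \<noteq> q k" if jk: "j < k" "k \<le> r" for j k
  proof
    assume eq: "q j = q k"
    \<comment> \<open>Cut out the loop between two visits; at the splice \<open>l = j\<close> the
      edge leaving \<open>q k\<close> serves, since \<open>q j = q k\<close>.\<close>
    define q' where "q' l = (if l \<le> j then q l else q (l + (k - j)))" for l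
    have "W (n - (k - j))" unfolding W_def
    proof (intro exI[of _ q'] conjI allI impI)
      show "q' 0 \<in> S1" using q by (simp add: q'_def)
      have "\<not> n - (k - j) \<le> j" "n - (k - j) + (k - j) = n" using jk r by auto
      then show "q' (n - (k - j)) \<in> S2" using q by (simp add: q'_def)
      fix l
      show "q' l \<in> A" if "l \<le> n - (k - j)" using that q jk r by (simp add: q'_def)
      show "R (q' l) (q' (Suc l))" if l: "l < n - (k - j)"
      proof -
        consider "l < j" | "l = j" | "l > j" by linarith
        then show ?thesis
        proof cases
          case 1 then show ?thesis using q(4)[of l] jk r by (simp add: q'_def)
        next
          case 2 then show ?thesis using q(4)[of k] jk r eq by (simp add: q'_def)
        next
          case 3 then show ?thesis using q(4)[of "l + (k - j)"] jk r l by (simp add: q'_def)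
        qed
      qed
    qed
    moreover have "n - (k - j) < n" using jk r by linarith
    ultimately show False using min by blast
  qed
  show ?thesis
  proof (rule that[of q r])
    show "inj_on q {1..r}" unfolding inj_on_def using neq by (metis atLeastAtMost_iff linorder_neqE_nat)
  qed (use q int r in auto)
qed

section \<open>Resonant circuits\<close>

definition step :: "('a \<Rightarrow> 'm::finite \<Rightarrow> int) \<Rightarrow> 'a \<Rightarrow> 'a \<Rightarrow> bool" where
  "step P u v \<longleftrightarrow> (\<Sum>k\<in>UNIV. \<bar>P u k - P v k\<bar>) = 2"

definition affine_relation :: "('a \<Rightarrow> 'm::finite \<Rightarrow> int) \<Rightarrow> 'a set \<Rightarrow> ('a \<Rightarrow> real) \<Rightarrow> bool" where
  "affine_relation P A n \<longleftrightarrow> (\<Sum>s\<in>A. n s) = 0 \<and> (\<forall>k. (\<Sum>s\<in>A. n s * P s k) = 0)"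

lemma symp_step: "symp (step P)"
  by (simp add: symp_def step_def abs_minus_commute)

text \<open>The situation of a minimal connected dependent set without double steps, from which a
  contradiction is derived. \<open>unique\<close> says that the relations form a line.\<close>

locale resonant_circuit =
  fixes A :: "'a set" and P :: "'a \<Rightarrow> 'm::finite \<Rightarrow> int" and N :: "'a \<Rightarrow> real"
  assumes finite_A: "finite A"
    and inj_P: "inj_on P A"
    and relation: "affine_relation P A N"
    and nonzero: "\<exists>s\<in>A. N s \<noteq> 0"
    and unique: "affine_relation P A n \<Longrightarrow> \<exists>c. \<forall>s\<in>A. n s = c * N s"
    and orth: "i \<noteq> j \<Longrightarrow> (\<Sum>s\<in>A. N s * P s i * P s j) = 0"
    and linked_A: "linked (step P) A"
    and parity: "u \<in> A \<Longrightarrow> v \<in> A \<Longrightarrow> even (\<Sum>k\<in>UNIV. P u k - P v k)"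
    and no_double: "u \<in> A \<Longrightarrow> v \<in> A \<Longrightarrow> P u k - P v k = 2 \<Longrightarrow> \<exists>l. l \<noteq> k \<and> P u l \<noteq> P v l"
begin

lemma sum_N: "(\<Sum>s\<in>A. N s) = 0" and sum_NP: "(\<Sum>s\<in>A. N s * P s k) = 0"
  using relation by (auto simp: affine_relation_def)

definition S where "S = {s \<in> A. N s \<noteq> 0}"

text \<open>By \<open>orth\<close> the matrix of second moments with weights \<open>N\<close> is
  diagonal; these are its diagonal entries, possibly zero or negative.\<close>

definition W :: "'m \<Rightarrow> real" where "W k = (\<Sum>s\<in>A. N s * P s k * P s k)"

lemma S_subset: "S \<subseteq> A" and finite_S: "finite S"
  using finite_A by (auto simp: S_def)

lemma sum_S: "(\<Sum>s\<in>A. N s * g s) = (\<Sum>s\<in>S. N s * g s)"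
  unfolding S_def using finite_A by (intro sum.mono_neutral_right) auto

text \<open>Since \<open>N\<close> is the only relation, the points other than \<open>s0\<close> are affinely independent and
  \<open>\<phi>\<close> can be prescribed there; the relation then gives the value at \<open>s0\<close>.\<close>

lemma affine_interpolation:
  fixes \<phi> :: "'a \<Rightarrow> real"
  assumes phi: "(\<Sum>s\<in>A. N s * \<phi> s) = 0"
  obtains c :: real and lam :: "'m \<Rightarrow> real" where "\<And>s. s \<in> A \<Longrightarrow> \<phi> s = c + (\<Sum>k\<in>UNIV. lam k * P s k)"
    "\<And>k. lam k * W k = (\<Sum>s\<in>A. N s * \<phi> s * P s k)"
proof -
  obtain s0 where s0: "s0 \<in> A" "N s0 \<noteq> 0" using nonzero by blast
  \<comment> \<open>The extra coordinate 1 turns affine relations into linear ones.\<close>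
  define e :: "'a \<Rightarrow> (real^'m) \<times> real" where "e s = (\<chi> k. P s k, 1)" for s
  define B where "B = e ` (A - {s0})"
  have inj: "inj_on e A"
    using inj_P by (auto simp: inj_on_def e_def vec_eq_iff fun_eq_iff)
  then have inj': "inj_on e (A - {s0})" by (rule inj_on_subset) auto
  have "independent B"
  proof
    assume "dependent B"
    moreover have "finite B" using finite_A by (simp add: B_def)
    ultimately obtain u where u: "\<exists>v\<in>B. u v \<noteq> 0" "(\<Sum>v\<in>B. u v *\<^sub>R v) = 0"
      by (auto simp: dependent_finite)
    define n where "n s = (if s = s0 then 0 else u (e s))" for s
    have n: "(\<Sum>s\<in>A. n s * g s) = (\<Sum>s\<in>A - {s0}. u (e s) * g s)" for g
      using finite_A by (intro sum.mono_neutral_cong_right) (auto simp: n_def)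
    have "(\<Sum>s\<in>A - {s0}. u (e s) *\<^sub>R e s) = 0"
      using u(2) unfolding B_def by (subst (asm) sum.reindex[OF inj']) simp
    then have "fst (\<Sum>s\<in>A - {s0}. u (e s) *\<^sub>R e s) = 0" "snd (\<Sum>s\<in>A - {s0}. u (e s) *\<^sub>R e s) = 0"
      by simp_all
    then have "(\<Sum>s\<in>A - {s0}. u (e s) * P s k) = 0" "(\<Sum>s\<in>A - {s0}. u (e s)) = 0" for k
      by (auto simp: e_def fst_sum snd_sum vec_eq_iff)
    then have "affine_relation P A n"
      using n[of "\<lambda>_. 1"] n by (simp add: affine_relation_def)
    then obtain c where c: "\<And>s. s \<in> A \<Longrightarrow> n s = c * N s" using unique by blast
    have "c = 0" using c[OF s0(1)] s0 by (simp add: n_def)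
    then have "u (e s) = 0" if "s \<in> A - {s0}" for s using c[of s] that by (simp add: n_def)
    then show False using u(1) by (auto simp: B_def)
  qed
  then obtain g :: "(real^'m) \<times> real \<Rightarrow> real" where g: "linear g" "\<And>v. v \<in> B \<Longrightarrow> g v = \<phi> (inv_into A e v)"
    using linear_independent_extend[of B "\<lambda>v. \<phi> (inv_into A e v)"] by blast
  define c where "c = g (0, 1)"
  define lam where "lam k = g (axis k 1, 0)" for k
  have ge: "g (e s) = c + (\<Sum>k\<in>UNIV. lam k * P s k)" for s
  proof -
    have "(\<chi> k. real_of_int (P s k)) = (\<Sum>k\<in>UNIV. real_of_int (P s k) *\<^sub>R axis k 1)"
      using basis_expansion[of "\<chi> k. real_of_int (P s k)"] by (simp add: scalar_mult_eq_scaleR)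
    then have "e s = (0, 1) + (\<Sum>k\<in>UNIV. P s k *\<^sub>R (axis k 1, 0))"
      unfolding e_def by (auto simp: prod_eq_iff fst_sum snd_sum)
    then show ?thesis
      using g(1)
      by (simp add: linear_add linear_sum linear_scale c_def lam_def mult.commute del: scaleR_Pair)
  qed
  have geA: "g (e s) = \<phi> s" if "s \<in> A - {s0}" for s
    using g(2)[of "e s"] that inj by (simp add: B_def)
  \<comment> \<open>\<open>N\<close> annihilates affine functions, and \<phi> by assumption.
    Agreement away from \<open>s0\<close> then gives agreement at \<open>s0\<close>, where
    \<open>N\<close> is nonzero.\<close>
  have Ng: "(\<Sum>s\<in>A. N s * g (e s)) = 0"
  proof -
    have "(\<Sum>s\<in>A. N s * g (e s)) = c * (\<Sum>s\<in>A. N s) + (\<Sum>k\<in>UNIV. lam k * (\<Sum>s\<in>A. N s * P s k))"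
      unfolding ge
      by (simp add: distrib_left sum.distrib sum_distrib_left sum_distrib_right mult_ac)
         (rule sum.swap)
    then show ?thesis using sum_N sum_NP by simp
  qed
  have "N s0 * g (e s0) + (\<Sum>s\<in>A - {s0}. N s * \<phi> s) = 0"
    using Ng finite_A s0 geA by (simp add: sum.remove[of A s0])
  moreover have "N s0 * \<phi> s0 + (\<Sum>s\<in>A - {s0}. N s * \<phi> s) = 0"
    using phi finite_A s0 by (simp add: sum.remove[of A s0])
  ultimately have "N s0 * g (e s0) = N s0 * \<phi> s0" by linarith
  then have "g (e s) = \<phi> s" if "s \<in> A" for s using geA s0 that by (cases "s = s0") auto
  then have main: "\<phi> s = c + (\<Sum>k\<in>UNIV. lam k * P s k)" if "s \<in> A" for s using ge[of s] that by simp
  have "lam k * W k = (\<Sum>s\<in>A. N s * \<phi> s * P s k)" for k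
  proof -
    have "(\<Sum>s\<in>A. N s * \<phi> s * P s k)
        = (\<Sum>s\<in>A. N s * (c + (\<Sum>l\<in>UNIV. lam l * P s l)) * P s k)"
      using main by (intro sum.cong) auto
    also have "\<dots> = c * (\<Sum>s\<in>A. N s * P s k)
        + (\<Sum>l\<in>UNIV. lam l * (\<Sum>s\<in>A. N s * P s l * P s k))"
      by (simp add: distrib_left distrib_right sum.distrib sum_distrib_left sum_distrib_right mult_ac)
         (rule sum.swap)
    also have "(\<Sum>l\<in>UNIV. lam l * (\<Sum>s\<in>A. N s * P s l * P s k)) = (\<Sum>l\<in>UNIV. if l = k then lam k * W k else 0)"
      using orth by (intro sum.cong) (auto simp: W_def)
    finally show ?thesis using sum_NP by simp
  qed
  with main show ?thesis using that by blast
qed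

section \<open>Indicator differences and the orthocentric form\<close>

lemma indicator_difference:
  assumes "p \<in> S" "q \<in> S" "p \<noteq> q"
  obtains c :: real and lam :: "'m \<Rightarrow> real" where
    "\<And>s. s \<in> A \<Longrightarrow> (of_bool (s = p) / N p - of_bool (s = q) / N q) = c + (\<Sum>k\<in>UNIV. lam k * P s k)"
    "\<And>k. lam k * W k = real_of_int (P p k - P q k)"
proof -
  \<comment> \<open>The divisors make the sum weighted by \<open>N\<close> equal to 1 - 1 = 0, so
    that interpolation applies; against \<open>g\<close> the weighted sum becomes
    \<open>g p - g q\<close>.\<close>
  define \<phi> :: "'a \<Rightarrow> real" where "\<phi> s = of_bool (s = p) / N p - of_bool (s = q) / N q" for s
  have ev: "(\<Sum>s\<in>A. N s * \<phi> s * g s) = g p - g q" for g :: "'a \<Rightarrow> real"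
  proof -
    have "(\<Sum>s\<in>A. N s * \<phi> s * g s) = (\<Sum>s\<in>A. (if s = p then g p else 0) - (if s = q then g q else 0))"
      using assms by (intro sum.cong) (auto simp: \<phi>_def S_def)
    also have "\<dots> = g p - g q"
      using assms finite_A by (simp add: sum_subtractf S_def)
    finally show ?thesis .
  qed
  have 0: "(\<Sum>s\<in>A. N s * \<phi> s) = 0" using ev[of "\<lambda>_. 1"] by simp
  obtain c :: real and lam :: "'m \<Rightarrow> real" where 1: "\<And>s. s \<in> A \<Longrightarrow> \<phi> s = c + (\<Sum>k\<in>UNIV. lam k * P s k)"
    and 2: "\<And>k. lam k * W k = (\<Sum>s\<in>A. N s * \<phi> s * P s k)"
    by (rule affine_interpolation[OF 0]) blast
  show ?thesis
  proof (rule that[of c lam])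
    show "lam k * W k = real_of_int (P p k - P q k)" for k unfolding 2 ev by simp
  qed (use 1 in \<open>simp add: \<phi>_def\<close>)
qed

lemma constant_on_S:
  assumes "W k = 0" "p \<in> S" "q \<in> S"
  shows "P p k = P q k"
proof (cases "p = q")
  case False
  obtain lam :: "'m \<Rightarrow> real" where "\<And>k. lam k * W k = real_of_int (P p k - P q k)"
    by (rule indicator_difference[OF assms(2,3) False]) blast
  from this[of k] show ?thesis using assms by simp
qed auto

text \<open>The product of \<open>p - q\<close> and \<open>s - t\<close>. Since division by zero
  gives zero, coordinates with \<open>W k = 0\<close> drop out; they are constant on
  \<open>S\<close> anyway.\<close>

definition Q :: "'a \<Rightarrow> 'a \<Rightarrow> 'a \<Rightarrow> 'a \<Rightarrow> real" where
  "Q p q s t = (\<Sum>k\<in>UNIV. (P p k - P q k) * (P s k - P t k) / W k)"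

text \<open>Pairing with \<open>p - q\<close> is the linear part of the affine function that
  interpolates the indicator difference, and its values at \<open>s\<close> and \<open>t\<close> are
  known.\<close>

lemma Q_eq:
  assumes "p \<in> S" "q \<in> S" "p \<noteq> q" "s \<in> S" "t \<in> S"
  shows "Q p q s t = (of_bool (s = p) - of_bool (t = p)) / N p - (of_bool (s = q) - of_bool (t = q)) / N q"
proof -
  obtain c :: real and lam :: "'m \<Rightarrow> real" where 1: "\<And>s. s \<in> A \<Longrightarrow>
      (of_bool (s = p) / N p - of_bool (s = q) / N q) = c + (\<Sum>k\<in>UNIV. lam k * P s k)"
    and 2: "\<And>k. lam k * W k = real_of_int (P p k - P q k)"
    by (rule indicator_difference[OF assms(1-3)]) blast
  have "Q p q s t = (\<Sum>k\<in>UNIV. lam k * (P s k - P t k))"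
    unfolding Q_def
  proof (rule sum.cong)
    fix k
    show "real_of_int ((P p k - P q k) * (P s k - P t k)) / W k = lam k * real_of_int (P s k - P t k)"
    proof (cases "W k = 0")
      \<comment> \<open>Here \<open>lam k\<close> is undetermined, but \<open>s\<close> and
        \<open>t\<close> agree in coordinate \<open>k\<close>.\<close>
      case True
      then show ?thesis using constant_on_S[of k s t] assms by simp
    next
      case False
      then show ?thesis unfolding of_int_mult 2[of k, symmetric] by simp
    qed
  qed simp
  also have "\<dots> = (of_bool (s = p) / N p - of_bool (s = q) / N q) - (of_bool (t = p) / N p - of_bool (t = q) / N q)"
    using 1 assms S_subset by (simp add: subset_iff right_diff_distrib sum_subtractf)
  finally show ?thesis by (simp add: diff_divide_distrib)
qed

lemma Q_common: "\<lbrakk>p \<in> S; q \<in> S; c \<in> S; p \<noteq> q; p \<noteq> c; q \<noteq> c\<rbrakk> \<Longrightarrow> Q p c q c = 1 / N c"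
  by (simp add: Q_eq)

lemma Q_disjoint:
  "\<lbrakk>p \<in> S; q \<in> S; s \<in> S; t \<in> S; p \<noteq> q; s \<noteq> p; s \<noteq> q; t \<noteq> p; t \<noteq> q\<rbrakk> \<Longrightarrow> Q p q s t = 0"
  by (simp add: Q_eq)

end

section \<open>Paths outside the support\<close>

lemma abs_diff_le_variation:
  fixes f :: "nat \<Rightarrow> int"
  assumes "a \<le> b" "b \<le> n"
  shows "\<bar>f b - f a\<bar> \<le> (\<Sum>l\<in>{a..<n}. \<bar>f (Suc l) - f l\<bar>)"
proof -
  have "\<bar>f b - f a\<bar> = \<bar>\<Sum>l\<in>{a..<b}. f (Suc l) - f l\<bar>"
    using assms by (simp add: sum_Suc_diff')
  also have "\<dots> \<le> (\<Sum>l\<in>{a..<b}. \<bar>f (Suc l) - f l\<bar>)" by (rule sum_abs)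
  also have "\<dots> \<le> (\<Sum>l\<in>{a..<n}. \<bar>f (Suc l) - f l\<bar>)"
    using assms by (intro sum_mono2) auto
  finally show ?thesis .
qed

lemma closed_variation_ge_2:
  fixes f :: "nat \<Rightarrow> int"
  assumes "b \<le> n" "f n = f 0" "f b \<noteq> f 0"
  shows "2 \<le> (\<Sum>l\<in>{0..<n}. \<bar>f (Suc l) - f l\<bar>)"
proof -
  have "1 \<le> \<bar>f b - f 0\<bar>" "1 \<le> \<bar>f n - f b\<bar>" using assms by auto
  moreover have "\<bar>f b - f 0\<bar> \<le> (\<Sum>l\<in>{0..<b}. \<bar>f (Suc l) - f l\<bar>)"
    by (rule abs_diff_le_variation) auto
  moreover have "\<bar>f n - f b\<bar> \<le> (\<Sum>l\<in>{b..<n}. \<bar>f (Suc l) - f l\<bar>)"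
    using assms by (intro abs_diff_le_variation) auto
  moreover have "(\<Sum>l\<in>{0..<n}. \<bar>f (Suc l) - f l\<bar>)
      = (\<Sum>l\<in>{0..<b}. \<bar>f (Suc l) - f l\<bar>) + (\<Sum>l\<in>{b..<n}. \<bar>f (Suc l) - f l\<bar>)"
    using assms by (simp add: sum.atLeastLessThan_concat)
  ultimately show ?thesis by linarith
qed

context resonant_circuit
begin

text \<open>The indicator of a point outside \<open>S\<close> is an affine function of the coordinates that are
  constant on \<open>S\<close>. So at least \<open>r\<close> such coordinates vary along a path with \<open>r\<close> inner points
  outside \<open>S\<close>; each returns to its initial value and thus uses up two units of length.\<close>

lemma path_outside_S:
  assumes ends: "q 0 \<in> S" "q (Suc r) \<in> S"
    and steps: "\<And>l. l \<le> r \<Longrightarrow> step P (q l) (q (Suc l))"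
    and inner: "\<And>l. 1 \<le> l \<Longrightarrow> l \<le> r \<Longrightarrow> q l \<in> A - S"
    and inj: "inj_on q {1..r}"
  shows "(\<Sum>k\<in>UNIV. \<bar>P (q (Suc r)) k - P (q 0) k\<bar>) \<le> 2"
proof -
  define J where "J = {k. W k = 0 \<and> (\<exists>l\<in>{1..r}. P (q l) k \<noteq> P (q 0) k)}"
  define u :: "nat \<Rightarrow> real^'m"
    where "u l = (\<chi> k. if k \<in> J then P (q l) k - P (q 0) k else 0)" for l
  \<comment> \<open>\<open>N\<close> vanishes at the inner point \<open>q l\<close>, so the
    coefficients of its interpolated indicator satisfy \<open>lam k * W k = 0\<close>. Only
    coordinates constant on \<open>S\<close> enter, which yields a functional dual to
    \<open>u l\<close>.\<close>
  have dual: "\<exists>lam. \<forall>l'\<in>{1..r}. (\<Sum>k\<in>UNIV. lam k * u l' $ k) = of_bool (l' = l)"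
    if l: "l \<in> {1..r}" for l
  proof -
    define \<phi> :: "'a \<Rightarrow> real" where "\<phi> s = of_bool (s = q l)" for s
    have Nl: "N (q l) = 0" "q l \<notin> S" using inner[of l] l by (auto simp: S_def)
    have zero: "(\<Sum>s\<in>A. N s * \<phi> s * g s) = 0" for g
      by (rule sum.neutral) (use Nl in \<open>auto simp: \<phi>_def\<close>)
    have "(\<Sum>s\<in>A. N s * \<phi> s) = 0" using zero[of "\<lambda>_. 1"] by simp
    then obtain c :: real and lam :: "'m \<Rightarrow> real"
      where 1: "\<And>s. s \<in> A \<Longrightarrow> \<phi> s = c + (\<Sum>k\<in>UNIV. lam k * P s k)"
        and "\<And>k. lam k * W k = (\<Sum>s\<in>A. N s * \<phi> s * P s k)"
      by (rule affine_interpolation) blast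
    then have 2: "lam k * W k = 0" for k using zero by simp
    have "(\<Sum>k\<in>UNIV. lam k * u l' $ k) = of_bool (l' = l)" if l': "l' \<in> {1..r}" for l'
    proof -
      have "(\<Sum>k\<in>UNIV. lam k * u l' $ k) = (\<Sum>k\<in>UNIV. lam k * (P (q l') k - P (q 0) k))"
      proof (rule sum.cong)
        fix k
        show "lam k * u l' $ k = lam k * (P (q l') k - P (q 0) k)"
          using 2[of k] l' by (cases "W k = 0") (auto simp: u_def J_def)
      qed simp
      also have "\<dots> = \<phi> (q l') - \<phi> (q 0)"
        using 1[of "q l'"] 1[of "q 0"] inner[of l'] l' ends S_subset
        by (simp add: subset_iff right_diff_distrib sum_subtractf)
      also have "\<dots> = of_bool (l' = l)"
        using Nl ends inj l l' by (auto simp: \<phi>_def inj_on_eq_iff)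
      finally show ?thesis .
    qed
    then show ?thesis by blast
  qed
  have inj_u: "inj_on u {1..r}"
  proof (rule inj_onI)
    fix l l' assume l: "l \<in> {1..r}" "l' \<in> {1..r}" "u l = u l'"
    obtain lam where lam: "\<forall>l'\<in>{1..r}. (\<Sum>k\<in>UNIV. lam k * u l' $ k) = of_bool (l' = l)"
      using dual[OF l(1)] by blast
    have "of_bool (l' = l) = (\<Sum>k\<in>UNIV. lam k * u l $ k)"
      using lam l(2,3) by metis
    also have "\<dots> = 1" using lam l(1) by simp
    finally have "of_bool (l' = l) = (1::real)" .
    then show "l = l'" by (metis of_bool_eq_1_iff)
  qed
  have ind: "independent (u ` {1..r})"
  proof
    assume "dependent (u ` {1..r})"
    then obtain c where c: "\<exists>v\<in>u ` {1..r}. c v \<noteq> 0" "(\<Sum>v\<in>u ` {1..r}. c v *\<^sub>R v) = 0"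
      by (subst (asm) dependent_finite) (simp, blast)
    then obtain l where l: "l \<in> {1..r}" "c (u l) \<noteq> 0" by blast
    obtain lam where lam: "\<forall>l'\<in>{1..r}. (\<Sum>k\<in>UNIV. lam k * u l' $ k) = of_bool (l' = l)"
      using dual[OF l(1)] by blast
    have "(\<Sum>l'\<in>{1..r}. c (u l') *\<^sub>R u l') = 0"
      using c(2) sum.reindex[OF inj_u, of "\<lambda>v. c v *\<^sub>R v"] by (simp only: o_def)
    then have "(\<Sum>l'\<in>{1..r}. c (u l') *\<^sub>R u l') $ k = 0" for k by (simp only: zero_index)
    then have z: "(\<Sum>l'\<in>{1..r}. c (u l') * u l' $ k) = 0" for k by simp
    have "0 = (\<Sum>k\<in>UNIV. lam k * (\<Sum>l'\<in>{1..r}. c (u l') * u l' $ k))"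
      by (simp only: z mult_zero_right sum.neutral_const)
    also have "\<dots> = (\<Sum>l'\<in>{1..r}. c (u l') * (\<Sum>k\<in>UNIV. lam k * u l' $ k))"
      by (simp add: sum_distrib_left mult_ac) (rule sum.swap)
    also have "\<dots> = (\<Sum>l'\<in>{1..r}. if l' = l then c (u l) else 0)"
      using lam by (intro sum.cong) auto
    also have "\<dots> = c (u l)" using l by simp
    finally show False using l by simp
  qed
  \<comment> \<open>The \<open>r\<close> independent displacements live on the coordinates in
    \<open>J\<close>, so \<open>r\<close> is at most \<open>card J\<close>.\<close>
  have "u ` {1..r} \<subseteq> span ((\<lambda>k. axis k 1) ` J)"
  proof clarify
    fix l
    have "u l = (\<Sum>k\<in>J. u l $ k *\<^sub>R axis k 1)"
    proof -
      have "u l = (\<Sum>k\<in>UNIV. u l $ k *\<^sub>R axis k 1)"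
        using basis_expansion[of "u l"] by (simp add: scalar_mult_eq_scaleR)
      also have "\<dots> = (\<Sum>k\<in>J. u l $ k *\<^sub>R axis k 1)"
        by (rule sum.mono_neutral_right) (auto simp: u_def)
      finally show ?thesis .
    qed
    also have "\<dots> \<in> span ((\<lambda>k. axis k 1) ` J)"
      by (intro span_sum span_scale span_base) auto
    finally show "u l \<in> span ((\<lambda>k. axis k 1) ` J)" .
  qed
  then have "card (u ` {1..r}) \<le> card ((\<lambda>k. axis k (1::real)) ` J)"
    by (intro independent_span_bound[OF _ ind, THEN conjunct2]) simp_all
  also have "\<dots> \<le> card J" by (simp add: card_image_le)
  finally have rJ: "r \<le> card J" unfolding card_image[OF inj_u] by simp
  define V where "V k = (\<Sum>l\<in>{0..<Suc r}. \<bar>P (q (Suc l)) k - P (q l) k\<bar>)" for k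
  have "(\<Sum>k\<in>UNIV. V k) = (\<Sum>l\<in>{0..<Suc r}. \<Sum>k\<in>UNIV. \<bar>P (q (Suc l)) k - P (q l) k\<bar>)"
    unfolding V_def by (rule sum.swap)
  also have "\<dots> = (\<Sum>l\<in>{0..<Suc r}. 2)"
    using steps by (intro sum.cong) (auto simp: step_def abs_minus_commute)
  finally have total: "(\<Sum>k\<in>UNIV. V k) = 2 * int r + 2" by simp
  \<comment> \<open>A coordinate in \<open>J\<close> agrees at both ends but varies in between,
    which costs 2; any other costs at least its net change.\<close>
  have V: "\<bar>P (q (Suc r)) k - P (q 0) k\<bar> + 2 * of_bool (k \<in> J) \<le> V k" for k
  proof (cases "k \<in> J")
    case True
    then obtain l where l: "l \<in> {1..r}" "P (q l) k \<noteq> P (q 0) k" by (auto simp: J_def)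
    have eq: "P (q (Suc r)) k = P (q 0) k"
      using True constant_on_S[OF _ ends(2,1)] by (simp add: J_def)
    moreover have "2 \<le> V k"
      unfolding V_def
      by (rule closed_variation_ge_2[of l "Suc r" "\<lambda>l. P (q l) k"]) (use l eq in auto)
    ultimately show ?thesis using True by simp
  next
    case False
    have "\<bar>P (q (Suc r)) k - P (q 0) k\<bar> \<le> V k"
      unfolding V_def by (rule abs_diff_le_variation) auto
    then show ?thesis using False by simp
  qed
  have "(\<Sum>k\<in>UNIV. \<bar>P (q (Suc r)) k - P (q 0) k\<bar>) + 2 * int (card J)
      = (\<Sum>k\<in>UNIV. \<bar>P (q (Suc r)) k - P (q 0) k\<bar> + 2 * of_bool (k \<in> J))"
    unfolding sum.distrib sum_distrib_left[symmetric] by simp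
  also have "\<dots> \<le> 2 * int r + 2" unfolding total[symmetric] by (rule sum_mono) (rule V)
  finally show ?thesis using rJ by linarith
qed

text \<open>A shortest path in \<open>A\<close> between two parts of \<open>S\<close> has its inner
  points outside \<open>S\<close>, so its ends are at distance at most 2. They are distinct and the
  distance is even, hence they are joined by an edge.\<close>

lemma linked_S: "linked (step P) S"
  unfolding linked_def
proof (intro allI impI)
  fix G assume G: "G \<subseteq> S" "G \<noteq> {}" "G \<noteq> S"
  then have 1: "G \<subseteq> A" "S - G \<subseteq> A" "S - G \<noteq> {}" "G \<inter> (S - G) = {}" using S_subset by auto
  obtain q r where q: "q 0 \<in> G" "q (Suc r) \<in> S - G" "\<And>l. l \<le> Suc r \<Longrightarrow> q l \<in> A"
    "\<And>l. l \<le> r \<Longrightarrow> step P (q l) (q (Suc l))"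
    "\<And>l. 1 \<le> l \<Longrightarrow> l \<le> r \<Longrightarrow> q l \<notin> G \<union> (S - G)" "inj_on q {1..r}"
    by (rule linked_simple_path[OF linked_A 1(1,2) G(2) 1(3,4)]) blast
  define d where "d k = P (q (Suc r)) k - P (q 0) k" for k
  have le: "(\<Sum>k\<in>UNIV. \<bar>d k\<bar>) \<le> 2"
    unfolding d_def
    by (rule path_outside_S) (use q G in auto)
  have "q 0 \<in> A" "q (Suc r) \<in> A" using q by auto
  moreover have "q 0 \<noteq> q (Suc r)" using q by auto
  ultimately have "P (q (Suc r)) \<noteq> P (q 0)" using inj_P by (metis inj_onD)
  then obtain k where "d k \<noteq> 0" by (auto simp: d_def fun_eq_iff)
  then have "(\<Sum>k\<in>UNIV. \<bar>d k\<bar>) > 0" by (intro sum_pos2[of _ k]) auto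
  moreover have "even (\<Sum>k\<in>UNIV. \<bar>d k\<bar>)"
  proof -
    have "even (\<Sum>k\<in>UNIV. \<bar>d k\<bar> - d k)" by (rule dvd_sum) (auto simp: abs_if)
    moreover have "even (\<Sum>k\<in>UNIV. d k)"
      unfolding d_def using \<open>q 0 \<in> A\<close> \<open>q (Suc r) \<in> A\<close> by (rule parity[rotated])
    ultimately show ?thesis by (simp add: sum_subtractf)
  qed
  ultimately have "(\<Sum>k\<in>UNIV. \<bar>d k\<bar>) = 2" using le by presburger
  then have "step P (q 0) (q (Suc r))" by (simp add: step_def d_def abs_minus_commute)
  then show "\<exists>u\<in>G. \<exists>v\<in>S - G. step P u v" using q by blast
qed

section \<open>Supports of edges\<close>

definition label :: "'a \<Rightarrow> 'a \<Rightarrow> 'm set" where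
  "label u v = {k. P u k \<noteq> P v k}"

lemma label_commute: "label u v = label v u"
  by (auto simp: label_def)

lemma step_commute: "step P u v \<longleftrightarrow> step P v u"
  using symp_step[of P] by (auto dest: sympD)

lemma step_neq: "step P u v \<Longrightarrow> u \<noteq> v"
  by (auto simp: step_def)

lemma no_double_abs:
  assumes "u \<in> A" "v \<in> A" "\<And>l. l \<noteq> k \<Longrightarrow> P u l = P v l" "\<bar>P u k - P v k\<bar> = 2"
  shows False
proof -
  have "P u k - P v k = 2 \<or> P v k - P u k = 2" using assms(4) by arith
  then show False using no_double[OF assms(1,2)] no_double[OF assms(2,1)] assms(3) by fastforce
qed

text \<open>An integral distance 2 is one change by 2, excluded by \<open>no_double\<close>, or two
  changes by 1.\<close>

lemma step_label:
  assumes uv: "u \<in> A" "v \<in> A" "step P u v"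
  shows "card (label u v) = 2" and "\<And>k. k \<in> label u v \<Longrightarrow> \<bar>P u k - P v k\<bar> = 1"
proof -
  define d where "d k = \<bar>P u k - P v k\<bar>" for k
  have sum_d: "(\<Sum>k\<in>UNIV. d k) = 2" using uv(3) by (simp add: step_def d_def)
  have le1: "d k \<le> 1" for k
  proof (rule ccontr)
    assume "\<not> d k \<le> 1"
    have split: "d k + (\<Sum>l\<in>UNIV - {k}. d l) = 2" using sum_d by (simp add: sum.remove[of UNIV k])
    have nonneg: "(\<Sum>l\<in>UNIV - {k}. d l) \<ge> 0" by (intro sum_nonneg) (simp add: d_def)
    have dk: "d k = 2" and "(\<Sum>l\<in>UNIV - {k}. d l) = 0" using split nonneg \<open>\<not> d k \<le> 1\<close> by linarith+
    then have "\<forall>l\<in>UNIV - {k}. d l = 0"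
      by (subst (asm) sum_nonneg_eq_0_iff) (auto simp: d_def)
    then have other: "P u l = P v l" if "l \<noteq> k" for l using that by (auto simp: d_def)
    show False by (rule no_double_abs[OF uv(1,2) other]) (use dk in \<open>auto simp: d_def\<close>)
  qed
  show one: "\<bar>P u k - P v k\<bar> = 1" if "k \<in> label u v" for k
    using le1[of k] that by (auto simp: d_def label_def)
  have "(\<Sum>k\<in>UNIV. d k) = (\<Sum>k\<in>label u v. d k)"
    by (rule sum.mono_neutral_right) (auto simp: d_def label_def)
  also have "\<dots> = (\<Sum>k\<in>label u v. 1)" by (rule sum.cong) (auto simp: d_def one)
  finally show "card (label u v) = 2" using sum_d by simp
qed

lemma W_nonzero:
  assumes "u \<in> S" "v \<in> S" "k \<in> label u v"
  shows "W k \<noteq> 0"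
  using constant_on_S[of k u v] assms by (auto simp: label_def)

lemma Q_label: "Q p q s t = (\<Sum>k\<in>label p q \<inter> label s t. (P p k - P q k) * (P s k - P t k) / W k)"
  unfolding Q_def by (rule sum.mono_neutral_right) (auto simp: label_def)

text \<open>Orthogonality survives moving the origin to \<open>c\<close>, because \<open>N\<close>
  annihilates constants and coordinates.\<close>

lemma sum_products:
  assumes "i \<noteq> j"
  shows "(\<Sum>s\<in>S. N s * (P s i - P c i) * (P s j - P c j)) = 0"
proof -
  have "(\<Sum>s\<in>A. N s * (real_of_int (P s i - P c i) * (P s j - P c j)))
     = (\<Sum>s\<in>A. N s * P s i * P s j) - P c j * (\<Sum>s\<in>A. N s * P s i)
       - P c i * (\<Sum>s\<in>A. N s * P s j) + P c i * P c j * (\<Sum>s\<in>A. N s)"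
    by (simp add: algebra_simps sum.distrib sum_subtractf sum_distrib_left sum_distrib_right)
  then show ?thesis using sum_S orth[OF assms] sum_NP sum_N by (simp add: mult.assoc)
qed

lemma N_nonzero: "s \<in> S \<Longrightarrow> N s \<noteq> 0" by (simp add: S_def)

lemma sum_N_S: "(\<Sum>s\<in>S. N s) = 0"
  using sum_S[of "\<lambda>_. 1"] sum_N by simp

text \<open>Disjoint supports would make the product zero, but it is \<open>1 / N c\<close>.\<close>

lemma adjacent_labels_meet:
  assumes S: "p \<in> S" "q \<in> S" "c \<in> S" and "p \<noteq> q" "step P p c" "step P q c"
  shows "label p c \<inter> label q c \<noteq> {}"
proof
  assume "label p c \<inter> label q c = {}"
  then have "Q p c q c = 0" by (simp add: Q_label)
  moreover have "Q p c q c = 1 / N c" using assms step_neq by (intro Q_common) auto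
  ultimately show False using N_nonzero S by simp
qed

text \<open>Equal labels at \<open>c\<close> force \<open>p\<close> and \<open>q\<close> to be opposite with respect to \<open>c\<close>; then a fourth
  point \<open>s\<close> would have opposite, but equal, products with \<open>p - c\<close> and \<open>q - c\<close>.\<close>

lemma adjacent_labels_differ:
  assumes S: "p \<in> S" "q \<in> S" "c \<in> S" and ne: "p \<noteq> q" and st: "step P p c" "step P q c"
  shows "label p c \<noteq> label q c"
proof
  assume eq: "label p c = label q c"
  have A: "p \<in> A" "q \<in> A" "c \<in> A" using S S_subset by auto
  have pc: "p \<noteq> c" "q \<noteq> c" using st step_neq by auto
  obtain a b where ab: "label p c = {a, b}" "a \<noteq> b"
    using step_label(1)[OF A(1,3) st(1)] by (auto simp: card_2_iff)
  have one: "\<bar>P p a - P c a\<bar> = 1" "\<bar>P q a - P c a\<bar> = 1" "\<bar>P p b - P c b\<bar> = 1" "\<bar>P q b - P c b\<bar> = 1"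
    using step_label(2)[OF A(1,3) st(1)] step_label(2)[OF A(2,3) st(2)] ab eq by auto
  have other: "P p k = P c k" "P q k = P c k" if "k \<noteq> a" "k \<noteq> b" for k
    using that ab eq by (auto simp: label_def)
  \<comment> \<open>Both points differ from \<open>c\<close> by 1 or -1 in \<open>a\<close> and
    \<open>b\<close> only. If they agreed in one of these, they would coincide or differ by 2 in the
    other alone.\<close>
  have opp: "P q k - P c k = - (P p k - P c k)" for k
  proof -
    have diff: "P p x \<noteq> P q x" if xy: "{x, y} = {a, b}" for x y
    proof
      assume eqx: "P p x = P q x"
      then have l: "P p l = P q l" if "l \<noteq> y" for l
        using other[of l] that xy by (cases "l = x") (auto simp: doubleton_eq_iff)
      have "P p \<noteq> P q" using inj_P A ne by (auto dest: inj_onD)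
      then have "P p y \<noteq> P q y" using l by (metis ext)
      then have "\<bar>P p y - P q y\<bar> = 2" using one xy by (auto simp: doubleton_eq_iff)
      with l show False by (rule no_double_abs[OF A(1,2)])
    qed
    have "P p a \<noteq> P q a" "P p b \<noteq> P q b" using diff[of a b] diff[of b a] by auto
    then have "P q a - P c a = - (P p a - P c a)" "P q b - P c b = - (P p b - P c b)"
      using one by arith+
    then show ?thesis using other[of k] by (cases "k = a"; cases "k = b") auto
  qed
  show False
  proof (cases "\<exists>s\<in>S. s \<notin> {p, q, c}")
    case True
    then obtain s where s: "s \<in> S" "s \<notin> {p, q, c}" by blast
    have "Q p c s c = 1 / N c" "Q q c s c = 1 / N c"
      using S s pc by (auto intro: Q_common)
    moreover have "Q q c s c = - Q p c s c"
      unfolding Q_def opp sum_negf[symmetric]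
      by (rule sum.cong[OF refl]) (simp only: mult_minus_left of_int_minus minus_divide_left)
    ultimately show False using N_nonzero S by simp
  next
    case False
    \<comment> \<open>Without a fourth point, orthogonality of \<open>a\<close> and \<open>b\<close>
      is used: \<open>p\<close> and \<open>q\<close> contribute equal products, so
      \<open>N p + N q = 0\<close> and thus \<open>N c = 0\<close>.\<close>
    then have Seq: "S = {p, q, c}" using S by auto
    have "N p * (P p a - P c a) * (P p b - P c b) + N q * (P q a - P c a) * (P q b - P c b) = 0"
      using sum_products[OF ab(2), of c] Seq ne pc by simp
    then have "(N p + N q) * (P p a - P c a) * (P p b - P c b) = 0"
      unfolding opp by (simp add: algebra_simps)
    moreover have "P p a - P c a \<noteq> 0" "P p b - P c b \<noteq> 0" using one by auto
    ultimately have "N p + N q = 0" by simp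
    moreover have "N p + N q + N c = 0" using sum_N_S Seq ne pc by (simp add: add.assoc)
    ultimately show False using N_nonzero S by simp
  qed
qed

text \<open>A single common coordinate would contribute the only term of \<open>Q p q s t\<close>,
  which is nonzero, whereas disjoint edges are orthogonal.\<close>

lemma disjoint_labels:
  assumes S: "p \<in> S" "q \<in> S" "s \<in> S" "t \<in> S" and ne: "s \<noteq> p" "s \<noteq> q" "t \<noteq> p" "t \<noteq> q"
    and st: "step P p q" "step P s t" and k: "k \<in> label p q" "k \<in> label s t"
  shows "label p q = label s t"
proof (rule ccontr)
  assume neq: "label p q \<noteq> label s t"
  have A: "p \<in> A" "q \<in> A" "s \<in> A" "t \<in> A" using S S_subset by auto
  have card: "card (label p q) = 2" "card (label s t) = 2" using step_label(1) A st by auto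
  have "label p q \<inter> label s t = {k}"
  proof (rule ccontr)
    assume "label p q \<inter> label s t \<noteq> {k}"
    then obtain l where l: "l \<noteq> k" "l \<in> label p q" "l \<in> label s t" using k by auto
    have "label p q = {k, l}" "label s t = {k, l}"
      using card k l by (auto simp: card_2_iff)
    then show False using neq by simp
  qed
  then have "Q p q s t = (P p k - P q k) * (P s k - P t k) / W k" by (simp add: Q_label)
  moreover have "Q p q s t = 0" using S ne st step_neq by (intro Q_disjoint) auto
  ultimately show False using k W_nonzero[OF S(1,2) k(1)] by (auto simp: label_def)
qed

text \<open>A further edge at \<open>p\<close> meets the label of \<open>p\<close>,
  \<open>c\<close>, which is that of \<open>s\<close>, \<open>t\<close>. Being disjoint from the
  edge \<open>s\<close>, \<open>t\<close>, it has the same label, which two edges at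
  \<open>p\<close> cannot share.\<close>

lemma parallel_edge_closed:
  assumes S: "p \<in> S" "c \<in> S" "s \<in> S" "t \<in> S" and ne: "s \<noteq> p" "s \<noteq> c" "t \<noteq> p" "t \<noteq> c"
    and st: "step P p c" "step P s t" and L: "label p c = label s t"
    and y: "y \<in> S" "step P p y"
  shows "y \<in> {p, c, s, t}"
proof (rule ccontr)
  assume "y \<notin> {p, c, s, t}"
  then have yn: "y \<noteq> p" "y \<noteq> c" "y \<noteq> s" "y \<noteq> t" by auto
  have st': "step P c p" "step P y p" using st(1) y(2) step_commute by blast+
  have "label y p \<inter> label c p \<noteq> {}"
    by (rule adjacent_labels_meet[OF y(1) S(2,1) yn(2) st'(2,1)])
  then obtain k where k: "k \<in> label y p" "k \<in> label s t" using L label_commute by auto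
  have "label y p = label s t"
    by (rule disjoint_labels[OF y(1) S(1,3,4) yn(3)[symmetric] ne(1) yn(4)[symmetric] ne(3) st'(2) st(2) k])
  moreover have "label y p \<noteq> label c p"
    by (rule adjacent_labels_differ[OF y(1) S(2,1) yn(2) st'(2,1)])
  ultimately show False using L label_commute by auto
qed

text \<open>Some coordinate \<open>k\<close> takes one value on \<open>p\<close>, \<open>c\<close>
  and another on \<open>s\<close>, \<open>t\<close>. Its first moment being zero forces
  \<open>N p + N c = 0\<close>, so \<open>W k = 0\<close> although \<open>k\<close> varies on
  \<open>S\<close>.\<close>

lemma parallel_edges_linked:
  assumes Seq: "S = {p, c, s, t}" and ne: "s \<noteq> p" "s \<noteq> c" "t \<noteq> p" "t \<noteq> c"
    and st: "step P p c" "step P s t" and L: "label p c = label s t"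
    and ps: "step P p s"
  shows False
proof -
  have S: "p \<in> S" "c \<in> S" "s \<in> S" "t \<in> S" using Seq by auto
  then have A: "p \<in> A" "c \<in> A" "s \<in> A" "t \<in> A" using S_subset by auto
  have pc: "p \<noteq> c" "s \<noteq> t" using st step_neq by auto
  have "label s p \<noteq> label c p"
    using adjacent_labels_differ[of s c p] S ne ps st step_commute by blast
  moreover have "card (label s p) = 2" "card (label c p) = 2"
    using step_label(1) A ps st step_commute by blast+
  ultimately have "\<not> label s p \<subseteq> label c p" by (metis card_subset_eq finite)
  then obtain k where k: "k \<in> label s p" "k \<notin> label c p" by blast
  then have "k \<notin> label p c" "k \<notin> label s t" using L label_commute by auto
  then have vals: "P c k = P p k" "P t k = P s k" by (auto simp: label_def)
  have diff: "real_of_int (P p k) \<noteq> P s k" using k(1) by (auto simp: label_def)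
  define n where "n = N p + N c"
  have sumS: "(\<Sum>x\<in>S. g x) = g p + g c + g s + g t" for g :: "'a \<Rightarrow> real"
    unfolding Seq using ne pc by simp
  have n: "N s + N t = - n" using sum_N_S unfolding sumS n_def by simp
  have "n * P p k + (N s + N t) * P s k = 0"
    using sum_NP[of k] unfolding sum_S sumS vals n_def by (simp add: algebra_simps)
  then have "n * (P p k - P s k) = 0" unfolding n by (simp add: algebra_simps)
  then have "n = 0" using diff by simp
  moreover have "W k = n * (P p k * P p k) + (N s + N t) * (P s k * P s k)"
    unfolding W_def mult.assoc sum_S sumS vals n_def by (simp add: algebra_simps)
  ultimately have "W k = 0" using n by simp
  then show False using W_nonzero[OF S(3,1) k(1)] by simp
qed

text \<open>Two disjoint edges with the same label cannot be left by any further edge, and an edge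
  between the two would carry a coordinate taking one value on each of them.\<close>

lemma parallel_edges:
  assumes S: "p \<in> S" "c \<in> S" "s \<in> S" "t \<in> S" and ne: "s \<noteq> p" "s \<noteq> c" "t \<noteq> p" "t \<noteq> c"
    and st: "step P p c" "step P s t" and L: "label p c = label s t"
  shows False
proof -
  have st': "step P c p" "step P t s" using st step_commute by blast+
  have L': "label c p = label s t" "label p c = label t s" "label c p = label t s"
    "label s t = label p c" "label t s = label p c" using L label_commute by auto
  have Seq: "S = {p, c, s, t}"
  proof (rule ccontr)
    assume neq: "S \<noteq> {p, c, s, t}"
    \<comment> \<open>The endpoint \<open>x\<close> may be any of the four points; symmetry gives
      each of them the role of \<open>p\<close>.\<close>
    obtain x y where xy: "x \<in> {p, c, s, t}" "y \<in> S - {p, c, s, t}" "step P x y"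
      by (rule linked_edge[OF linked_S, of "{p, c, s, t}"]) (use S neq in auto)
    then show False
      using parallel_edge_closed[OF S ne st L, of y]
        parallel_edge_closed[OF S(2,1,3,4) ne(2,1,4,3) st'(1) st(2) L'(1), of y]
        parallel_edge_closed[OF S(3,4,1,2) ne(1,3,2,4)[symmetric] st(2,1) L'(4), of y]
        parallel_edge_closed[OF S(4,3,1,2) ne(3,1,4,2)[symmetric] st'(2) st(1) L'(5), of y]
      by auto
  qed
  obtain x y where xy: "x \<in> {p, c}" "y \<in> S - {p, c}" "step P x y"
    by (rule linked_edge[OF linked_S, of "{p, c}"]) (use S ne in auto)
  have Seq': "S = {c, p, s, t}" "S = {p, c, t, s}" "S = {c, p, t, s}" using Seq by auto
  show False
    using parallel_edges_linked[OF Seq ne st L]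
      parallel_edges_linked[OF Seq'(1) ne(2,1,4,3) st'(1) st(2) L'(1)]
      parallel_edges_linked[OF Seq'(2) ne(3,4,1,2) st(1) st'(2) L'(2)]
      parallel_edges_linked[OF Seq'(3) ne(4,3,2,1) st' L'(3)] xy Seq
    by auto
qed

text \<open>Let \<open>p\<close> be a non-cut vertex of \<open>S\<close>, joined to \<open>c\<close> by an edge labelled \<open>{a, b}\<close>. If no edge
  parallel to it exists, then every other point differs from \<open>c\<close> in just one of the coordinates
  \<open>a\<close>, \<open>b\<close>, so that the orthogonality of these coordinates gives \<open>N p = 0\<close>.\<close>

lemma contradiction: False
proof -
  obtain x where x: "x \<in> A" "N x \<noteq> 0" using nonzero by blast
  then have xS: "x \<in> S" by (simp add: S_def)
  obtain y where y: "y \<in> S" "x \<noteq> y"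
  proof (cases "S = {x}")
    case True
    then show ?thesis using sum_N_S x by simp
  qed (use xS in blast)
  obtain p c where pc: "p \<in> S" "c \<in> S - {p}" "step P p c" and link: "linked (step P) (S - {p})"
    by (rule linked_non_cut_vertex[OF linked_S finite_S symp_step xS y]) blast
  have A: "p \<in> A" "c \<in> A" using pc S_subset by auto
  obtain a b where ab: "label p c = {a, b}" "a \<noteq> b"
    using step_label(1)[OF A pc(3)] by (auto simp: card_2_iff)
  \<comment> \<open>To get \<open>G = S - {p}\<close>, it is enough that no edge of the connected
    set \<open>S - {p}\<close> leaves \<open>G\<close>.\<close>
  define G where "G = {u \<in> S - {p}. u = c \<or> (P u a = P c a) \<noteq> (P u b = P c b)}"
  have "G = S - {p}"
  proof (rule ccontr)
    assume "G \<noteq> S - {p}"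
    moreover have "G \<subseteq> S - {p}" "c \<in> G" using pc by (auto simp: G_def)
    ultimately obtain u v where uv: "u \<in> G" "v \<in> S - {p} - G" "step P u v"
      using linked_edge[OF link, of G] by blast
    have uS: "u \<in> S" "u \<noteq> p" "v \<in> S" "v \<noteq> p" "v \<noteq> c" using uv \<open>c \<in> G\<close> by (auto simp: G_def)
    show False
    proof (cases "u = c")
      case True
      \<comment> \<open>Two labels of size 2 that meet without being equal share one coordinate, so
        \<open>v\<close> differs from \<open>c\<close> in just one of \<open>a\<close>,
        \<open>b\<close>.\<close>
      have m: "label v c \<inter> label p c \<noteq> {}" "label v c \<noteq> label p c"
        using adjacent_labels_meet[of v p c] adjacent_labels_differ[of v p c] uS pc uv True
          step_commute by auto
      moreover have "card (label v c) = 2" using uv True uS S_subset A step_commute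
        by (intro step_label(1)) auto
      ultimately have "(a \<in> label v c) \<noteq> (b \<in> label v c)"
        unfolding ab(1) using ab(2) by (auto simp: card_2_iff)
      then have "v \<in> G" using uS by (auto simp: G_def label_def)
      then show False using uv by blast
    next
      case False
      \<comment> \<open>An edge disjoint from \<open>p\<close>, \<open>c\<close> and not parallel to
        it changes neither \<open>a\<close> nor \<open>b\<close>.\<close>
      have "label p c \<noteq> label u v" using parallel_edges[of p c u v] uS pc uv False by auto
      then have "a \<notin> label u v" "b \<notin> label u v"
        using disjoint_labels[of p c u v] uS pc uv False ab by auto
      then have "P u a = P v a" "P u b = P v b" by (auto simp: label_def)
      then have "v \<in> G" using uv(1) uS False by (auto simp: G_def)
      then show False using uv by blast
    qed
  qed
  have zero: "P u a = P c a \<or> P u b = P c b" if "u \<in> S - {p}" for u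
  proof -
    have "u \<in> G" using that \<open>G = S - {p}\<close> by simp
    then show ?thesis by (auto simp: G_def)
  qed
  have "(\<Sum>s\<in>S. N s * (P s a - P c a) * (P s b - P c b))
      = N p * (P p a - P c a) * (P p b - P c b)
        + (\<Sum>s\<in>S - {p}. N s * (P s a - P c a) * (P s b - P c b))"
    using finite_S pc(1) by (rule sum.remove)
  also have "(\<Sum>s\<in>S - {p}. N s * (P s a - P c a) * (P s b - P c b)) = 0"
    by (rule sum.neutral) (use zero in auto)
  finally have "N p * (P p a - P c a) * (P p b - P c b) = 0"
    unfolding sum_products[OF ab(2)] by simp
  moreover have "P p a \<noteq> P c a" "P p b \<noteq> P c b" using ab by (auto simp: label_def)
  ultimately show False using N_nonzero pc by simp
qed

end

section \<open>Minimal dependent sets\<close>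

text \<open>If there is no double step, a connected dependent subset of least size is a resonant
  circuit, which cannot exist.\<close>

lemma resonant_configuration_has_double_step:
  fixes P :: "'a \<Rightarrow> 'm::finite \<Rightarrow> int"
  assumes fin: "finite A" and inj: "inj_on P A" and link: "linked (step P) A"
    and parity: "\<And>u v. u \<in> A \<Longrightarrow> v \<in> A \<Longrightarrow> even (\<Sum>k\<in>UNIV. P u k - P v k)"
    and dependent: "affine_relation P A n0" "\<exists>s\<in>A. n0 s \<noteq> 0"
    and resonant: "\<And>n i j. affine_relation P A n \<Longrightarrow> i \<noteq> j \<Longrightarrow> (\<Sum>s\<in>A. n s * P s i * P s j) = 0"
  shows "\<exists>u\<in>A. \<exists>v\<in>A. \<exists>k. P u k - P v k = 2 \<and> (\<forall>l. l \<noteq> k \<longrightarrow> P u l = P v l)"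
proof (rule ccontr)
  assume no: "\<not> ?thesis"
  define D where "D K \<longleftrightarrow> K \<subseteq> A \<and> linked (step P) K \<and> (\<exists>n. affine_relation P K n \<and> (\<exists>s\<in>K. n s \<noteq> 0))" for K
  have "D A" unfolding D_def using link dependent by blast
  then obtain K where K: "D K" and min: "\<And>L. card L < card K \<Longrightarrow> \<not> D L"
    using ex_has_least_nat[of D A card] by (metis not_le)
  have KA: "K \<subseteq> A" and linkK: "linked (step P) K" using K by (auto simp: D_def)
  have finK: "finite K" using KA fin by (rule finite_subset)
  obtain N s0 where N: "affine_relation P K N" and s0: "s0 \<in> K" "N s0 \<noteq> 0"
    using K by (auto simp: D_def)
  have "K \<noteq> {s0}" using N s0 by (auto simp: affine_relation_def)
  then obtain s1 where s1: "s1 \<in> K" "s0 \<noteq> s1" using s0 by blast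
  obtain p c where p: "p \<in> K" and "c \<in> K - {p}" "step P p c" and linkp: "linked (step P) (K - {p})"
    by (rule linked_non_cut_vertex[OF linkK finK symp_step s0(1) s1]) blast
  \<comment> \<open>Removing the non-cut vertex \<open>p\<close> keeps connectedness, so minimality
    forbids a nonzero relation without \<open>p\<close>. Relations on \<open>K\<close> are thus
    determined by their value at \<open>p\<close>.\<close>
  have vanish: "\<forall>s\<in>K. n s = 0" if n: "affine_relation P K n" "n p = 0" for n
  proof (rule ccontr)
    assume "\<not> (\<forall>s\<in>K. n s = 0)"
    then have "\<exists>s\<in>K - {p}. n s \<noteq> 0" using n(2) by blast
    moreover have "affine_relation P (K - {p}) n"
      using n finK by (simp add: affine_relation_def sum_diff1 p)
    ultimately have "D (K - {p})" using KA linkp by (auto simp: D_def)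
    moreover have "card (K - {p}) < card K" using finK p by (rule card_Diff1_less)
    ultimately show False using min by blast
  qed
  have "N p \<noteq> 0" using vanish[OF N] s0 by blast
  interpret resonant_circuit K P N
  proof
    show "finite K" by (rule finK)
    show "inj_on P K" using inj KA by (rule inj_on_subset)
    show "affine_relation P K N" by (rule N)
    show "\<exists>s\<in>K. N s \<noteq> 0" using s0 by blast
    show "linked (step P) K" by (rule linkK)
    show "\<exists>c. \<forall>s\<in>K. n s = c * N s" if n: "affine_relation P K n" for n
    proof -
      define r where "r = n p / N p"
      define m where "m s = n s - r * N s" for s
      have "affine_relation P K m"
        using n N by (simp add: affine_relation_def m_def left_diff_distrib sum_subtractf mult.assoc
            flip: sum_distrib_left)
      moreover have "m p = 0" using \<open>N p \<noteq> 0\<close> by (simp add: m_def r_def)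
      ultimately have "\<forall>s\<in>K. m s = 0" by (rule vanish)
      then show ?thesis by (intro exI[of _ r]) (simp add: m_def)
    qed
    show "(\<Sum>s\<in>K. N s * P s i * P s j) = 0" if "i \<noteq> j" for i j
    proof -
      \<comment> \<open>Resonance is given for relations on all of \<open>A\<close>, hence the
        extension by zero.\<close>
      define n where "n s = (if s \<in> K then N s else 0)" for s
      have n: "(\<Sum>s\<in>A. n s * g s) = (\<Sum>s\<in>K. N s * g s)" for g
        using fin KA by (intro sum.mono_neutral_cong_right) (auto simp: n_def)
      have "affine_relation P A n"
        using N n[of "\<lambda>_. 1"] n by (simp add: affine_relation_def)
      then have "(\<Sum>s\<in>A. n s * P s i * P s j) = 0" using that by (rule resonant)
      then show ?thesis using n[of "\<lambda>s. P s i * P s j"] by (simp add: mult.assoc)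
    qed
    show "even (\<Sum>k\<in>UNIV. P u k - P v k)" if "u \<in> K" "v \<in> K" for u v
      using that KA by (intro parity) auto
    show "\<exists>l. l \<noteq> k \<and> P u l \<noteq> P v l" if "u \<in> K" "v \<in> K" "P u k - P v k = 2" for u v k
      using that KA no by blast
  qed
  show False by (rule contradiction)
qed

section \<open>From integral relations to real ones\<close>

lemma rational_functional:
  fixes z :: real
  assumes "z \<noteq> 0"
  obtains \<phi> :: "real \<Rightarrow> rat" where "\<And>x y. \<phi> (x + y) = \<phi> x + \<phi> y" "\<And>q x. \<phi> (of_rat q * x) = q * \<phi> x" "\<phi> z = 1"
proof -
  interpret R: vector_space "\<lambda>(q::rat) (x::real). of_rat q * x"
    by standard (auto simp: algebra_simps of_rat_add of_rat_mult)
  interpret Q: vector_space "\<lambda>(q::rat) (x::rat). q * x"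
    by standard (auto simp: algebra_simps)
  interpret RQ: vector_space_pair "\<lambda>(q::rat) (x::real). of_rat q * x" "\<lambda>(q::rat) (x::rat). q * x" ..
  \<comment> \<open>\<open>z\<close> belongs to a basis of the reals over the rationals.\<close>
  have "\<not> R.dependent {z}" using assms by simp
  then obtain \<phi> where \<phi>: "Vector_Spaces.linear (\<lambda>q x. of_rat q * x) (*) \<phi>" "\<phi> z = (1::rat)"
    using RQ.linear_independent_extend[of "{z}" "\<lambda>_. 1"] by auto
  show ?thesis
    using \<phi>(2) RQ.linear_add[OF \<phi>(1)] RQ.linear_scale[OF \<phi>(1)] by (intro that[of \<phi>]) auto
qed

lemma common_denominator:
  fixes f :: "'a \<Rightarrow> rat"
  assumes "finite A"
  obtains d :: int and m :: "'a \<Rightarrow> int" where "d \<noteq> 0" "\<And>h. h \<in> A \<Longrightarrow> of_int d * f h = of_int (m h)"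
proof -
  have "\<exists>d. d \<noteq> 0 \<and> (\<forall>h\<in>A. \<exists>m. of_int d * f h = of_int m)" using assms
  proof induction
    case empty
    show ?case by (intro exI[of _ 1]) simp
  next
    case (insert h A)
    then obtain d where d: "d \<noteq> 0" "\<forall>h\<in>A. \<exists>m. of_int d * f h = of_int m" by blast
    obtain a b where ab: "quotient_of (f h) = (a, b)" by force
    then have fh: "f h = of_int a / of_int b" "b \<noteq> 0"
      using quotient_of_div[OF ab] quotient_of_denom_pos[OF ab] by auto
    have "\<exists>m. of_int (d * b) * f x = of_int m" if x: "x \<in> insert h A" for x
    proof (cases "x = h")
      case True
      then show ?thesis using fh by (intro exI[of _ "d * a"]) simp
    next
      case False
      then obtain m where "of_int d * f x = of_int m" using d x by blast
      then have "of_int (d * b) * f x = of_int (b * m)" by simp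
      then show ?thesis by blast
    qed
    then show ?case using d fh by (intro exI[of _ "d * b"]) auto
  qed
  then show ?thesis using that by metis
qed

text \<open>A functional of the rational vector space \<open>\<real>\<close> turns a real relation into a rational one.\<close>

lemma integral_relations_suffice:
  fixes a :: "'h \<Rightarrow> 'm \<Rightarrow> int" and c :: "'h \<Rightarrow> rat" and n :: "'h \<Rightarrow> real"
  assumes fin: "finite A"
    and int: "\<And>m :: 'h \<Rightarrow> int. (\<And>i. (\<Sum>h\<in>A. m h * a h i) = 0) \<Longrightarrow> (\<Sum>h\<in>A. of_int (m h) * c h) = 0"
    and n: "\<And>i. (\<Sum>h\<in>A. n h * a h i) = 0"
  shows "(\<Sum>h\<in>A. n h * of_rat (c h)) = 0"
proof (rule ccontr)
  assume "(\<Sum>h\<in>A. n h * of_rat (c h)) \<noteq> 0"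
  \<comment> \<open>\<phi> is normalized to 1 on the supposedly nonzero sum and commutes with the
    rational factors \<open>c h\<close>.\<close>
  then obtain \<phi> :: "real \<Rightarrow> rat" where add: "\<And>x y. \<phi> (x + y) = \<phi> x + \<phi> y"
    and scale: "\<And>q x. \<phi> (of_rat q * x) = q * \<phi> x"
    and one: "\<phi> (\<Sum>h\<in>A. n h * of_rat (c h)) = 1"
    by (rule rational_functional) blast
  have zero: "\<phi> 0 = 0" using scale[of 0 0] by simp
  have sum: "\<phi> (\<Sum>h\<in>A. n h * of_rat (q h)) = (\<Sum>h\<in>A. \<phi> (n h) * q h)" for q
    using fin
  proof induction
    case (insert h F)
    then show ?case using scale[of "q h" "n h"] by (simp add: add mult.commute)
  qed (simp add: zero)
  \<comment> \<open>Clearing denominators turns the rational relation \<open>\<phi> (n h)\<close>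
    into an integral one.\<close>
  obtain d m where d: "d \<noteq> 0" and m: "\<And>h. h \<in> A \<Longrightarrow> of_int d * \<phi> (n h) = of_int (m h)"
    by (rule common_denominator[OF fin, of "\<lambda>h. \<phi> (n h)"]) blast
  have md: "(\<Sum>h\<in>A. of_int (m h) * q h) = of_int d * \<phi> (\<Sum>h\<in>A. n h * of_rat (q h))" for q
    unfolding sum sum_distrib_left using m by (intro sum.cong) (auto simp flip: mult.assoc)
  have "(\<Sum>h\<in>A. m h * a h i) = 0" for i
  proof -
    have "(\<Sum>h\<in>A. of_int (m h) * rat_of_int (a h i)) = 0"
      unfolding md using n[of i] zero by simp
    then have "rat_of_int (\<Sum>h\<in>A. m h * a h i) = 0" by simp
    then show ?thesis by (simp only: of_int_eq_0_iff)
  qed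
  then have "(\<Sum>h\<in>A. of_int (m h) * c h) = 0" by (rule int)
  then show False using d one unfolding md by simp
qed

section \<open>The Cayley graph\<close>

lemma single_add_single_eq_iff:
  fixes i j k l :: 'a
  assumes "i \<noteq> j"
  shows "Poly_Mapping.single k (1::nat) + Poly_Mapping.single l 1
      = Poly_Mapping.single i 1 + Poly_Mapping.single j 1 \<longleftrightarrow> k = i \<and> l = j \<or> k = j \<and> l = i"
proof
  assume eq: "Poly_Mapping.single k (1::nat) + Poly_Mapping.single l 1
      = Poly_Mapping.single i 1 + Poly_Mapping.single j 1"
  have "(of_bool (k = x) + of_bool (l = x) :: nat) = of_bool (i = x) + of_bool (j = x)" for x
    using arg_cong[OF eq, of "\<lambda>p. Poly_Mapping.lookup p x"]
    by (auto simp: lookup_add lookup_single when_def of_bool_def split: if_splits)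
  from this[of i] this[of j] show "k = i \<and> l = j \<or> k = j \<and> l = i"
    using assms by (cases "k = i"; cases "k = j"; cases "l = i"; cases "l = j") simp_all
qed (auto simp: add.commute)

lemma of_int_times_Var:
  "of_int c * Var i = Poly_Mapping.single (Poly_Mapping.single i 1) (of_int c)"
  unfolding Var_def single_of_int[symmetric] mult_single by simp

lemma lookup_of_int_times:
  fixes p :: "'a::monoid_add \<Rightarrow>\<^sub>0 'b::ring_1"
  shows "Poly_Mapping.lookup (of_int c * p) k = of_int c * Poly_Mapping.lookup p k"
  by (induction c rule: int_induct[of _ 0]) (simp_all add: lookup_add lookup_minus algebra_simps)

text \<open>In the squared linear form a mixed monomial arises twice, once for each order of its
  factors, which cancels the factor 1/2; the sum of squares does not contain it.\<close>

lemma lookup_C: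
  fixes a :: "int ^ ('m::finite)"
  assumes "i \<noteq> j"
  shows "Poly_Mapping.lookup (C (a, s)) (Poly_Mapping.single i 1 + Poly_Mapping.single j 1)
    = sign s * of_int (a $ i * a $ j)"
proof -
  let ?e = "\<lambda>i. Poly_Mapping.single i (1::nat)"
  have delta: "(\<Sum>k\<in>UNIV. \<Sum>l\<in>UNIV. if k = i then if l = j then c else 0 else 0) = c"
    for i j :: 'm and c :: rat
  proof -
    have "(\<Sum>l\<in>UNIV. if k = i then if l = j then c else 0 else 0) = (if k = i then c else 0)" for k
      by (cases "k = i") simp_all
    then show ?thesis by simp
  qed
  note iff = single_add_single_eq_iff[OF assms, unfolded One_nat_def]
  have "linear_form a ^ 2 = (\<Sum>k\<in>UNIV. \<Sum>l\<in>UNIV. Poly_Mapping.single (?e k + ?e l) (of_int (a $ k * a $ l)))"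
    unfolding linear_form_def of_int_times_Var power2_eq_square sum_product mult_single by simp
  moreover have "sum_squares a = (\<Sum>k\<in>UNIV. Poly_Mapping.single (?e k + ?e k) (of_int (a $ k)))"
    unfolding sum_squares_def power2_eq_square mult.assoc[symmetric] of_int_times_Var
    by (simp add: Var_def mult_single)
  ultimately have C_eq: "C (a, s) =
      (\<Sum>k\<in>UNIV. \<Sum>l\<in>UNIV. Poly_Mapping.single (?e k + ?e l) (sign s / 2 * of_int (a $ k * a $ l)))
      + (\<Sum>k\<in>UNIV. Poly_Mapping.single (?e k + ?e k) (sign s / 2 * of_int (a $ k)))"
    by (simp add: Const_def distrib_left sum_distrib_left mult_single)
  have "Poly_Mapping.lookup (C (a, s)) (?e i + ?e j) =
      (\<Sum>k\<in>UNIV. \<Sum>l\<in>UNIV. if ?e k + ?e l = ?e i + ?e j then sign s / 2 * of_int (a $ k * a $ l) else 0)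
      + (\<Sum>k\<in>UNIV. if ?e k + ?e k = ?e i + ?e j then sign s / 2 * of_int (a $ k) else 0)"
    unfolding C_eq lookup_add lookup_sum lookup_single when_def by (rule refl)
  also have "(\<Sum>k\<in>UNIV. if ?e k + ?e k = ?e i + ?e j then sign s / 2 * of_int (a $ k) else 0) = (0::rat)"
    by (rule sum.neutral) (use assms in \<open>auto simp: iff\<close>)
  also have "(\<Sum>k\<in>UNIV. \<Sum>l\<in>UNIV. if ?e k + ?e l = ?e i + ?e j then sign s / 2 * of_int (a $ k * a $ l) else 0)
      = (\<Sum>k\<in>UNIV. \<Sum>l\<in>UNIV. (if k = i then if l = j then sign s / 2 * of_int (a $ i * a $ j) else 0 else 0)
        + (if k = j then if l = i then sign s / 2 * of_int (a $ i * a $ j) else 0 else (0::rat)))"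
    using assms by (intro sum.cong refl) (auto simp: iff mult.commute)
  also have "\<dots> = sign s * of_int (a $ i * a $ j)"
    unfolding sum.distrib delta by simp
  finally show ?thesis by simp
qed

text \<open>The points \<open>h x = \<sigma> x - \<pi>(a)\<close> are recorded by \<open>\<sigma> a\<close>: in this frame a red edge
  \<open>a + b = - e\<^sub>i - e\<^sub>j\<close> also becomes a difference, namely \<open>e\<^sub>i + e\<^sub>j\<close>.\<close>

definition vertex :: "('m::finite) elt \<Rightarrow> 'm \<Rightarrow> int" where
  "vertex h i = sign (snd h) * fst h $ i"

lemma sum_vertex: "h \<in> G_minus_2 \<Longrightarrow> (\<Sum>i\<in>UNIV. vertex h i) = (if snd h = Black then 0 else 2)"
  by (cases h; cases "snd h") (auto simp: vertex_def G_minus_2_def \<eta>_def sum_negf simp flip: sum_distrib_left)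

text \<open>The mass, 0 or 2, reveals the colour, and the colour restores the sign.\<close>

lemma vertex_inj: "inj_on vertex G_minus_2"
proof (rule inj_onI)
  fix h k :: "'m::finite elt" assume h: "h \<in> G_minus_2" "k \<in> G_minus_2" and eq: "vertex h = vertex k"
  have "snd h = snd k"
    using sum_vertex[OF h(1)] sum_vertex[OF h(2)] unfolding eq
    by (cases "snd h"; cases "snd k") auto
  moreover have "fst h $ i = fst k $ i" for i
    using fun_cong[OF eq, of i] \<open>snd h = snd k\<close> by (cases "snd k") (auto simp: vertex_def)
  ultimately show "h = k" by (simp add: prod_eq_iff vec_eq_iff)
qed

text \<open>Up to sign, a black edge shifts \<open>vertex\<close> by \<open>e i - e j\<close> and a
  red one by \<open>e i + e j\<close>.\<close>

lemma adjacent_step: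
  fixes u v :: "('m::finite) elt"
  assumes "adjacent u v"
  shows "step vertex u v"
proof -
  have axes: "(\<Sum>k\<in>UNIV. \<bar>of_bool (k = i) + c * of_bool (k = j)\<bar>) = (2::int)"
    if "i \<noteq> j" "\<bar>c\<bar> = 1" for i j :: 'm and c
  proof -
    have "(\<Sum>k\<in>UNIV. \<bar>of_bool (k = i) + c * of_bool (k = j)\<bar>)
        = (\<Sum>k\<in>UNIV. (if k = i then 1 else 0) + (if k = j then 1 else 0))"
      using that by (intro sum.cong) auto
    then show ?thesis by (simp add: sum.distrib)
  qed
  obtain x where x: "x \<in> X" "v = x \<otimes>\<^bsub>G\<^esub> u" using assms by (auto simp: adjacent_def)
  then consider i j where "i \<noteq> j" "x = (e i - e j, Black)"
    | i j where "i \<noteq> j" "x = (- e i - e j, Red)" by (auto simp: X_def)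
  then show ?thesis
  proof cases
    case 1
    have diff: "\<bar>vertex u k - vertex v k\<bar> = \<bar>of_bool (k = i) + - 1 * of_bool (k = j)\<bar>" for k
      by (cases u; cases "snd u") (auto simp: vertex_def 1 x(2) G_def e_def axis_def)
    show ?thesis unfolding step_def diff by (rule axes) (use 1 in auto)
  next
    case 2
    have diff: "\<bar>vertex u k - vertex v k\<bar> = \<bar>of_bool (k = i) + 1 * of_bool (k = j)\<bar>" for k
      by (cases u; cases "snd u") (auto simp: vertex_def 2 x(2) G_def e_def axis_def)
    show ?thesis unfolding step_def diff by (rule axes) (use 2 in auto)
  qed
qed

lemma is_graph_linked:
  assumes "is_graph A"
  shows "linked adjacent A"
  unfolding linked_def
proof (intro allI impI)
  fix U assume U: "U \<subseteq> A" "U \<noteq> {}" "U \<noteq> A"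
  then obtain u v where uv: "u \<in> U" "v \<in> A" "v \<notin> U" by blast
  have "(u, v) \<in> {(p, q). p \<in> A \<and> q \<in> A \<and> adjacent p q}\<^sup>*"
    using assms uv U by (auto simp: is_graph_def)
  then show "\<exists>p\<in>U. \<exists>q\<in>A - U. adjacent p q"
    using uv(1,3)
  proof (induction rule: converse_rtrancl_induct)
    case (step p q)
    then show ?case by (cases "q \<in> U") auto
  qed simp
qed

lemma linked_mono:
  assumes "linked R A" "\<And>u v. R u v \<Longrightarrow> R' u v"
  shows "linked R' A"
  unfolding linked_def
proof (intro allI impI)
  fix U assume "U \<subseteq> A" "U \<noteq> {}" "U \<noteq> A"
  then obtain u v where "u \<in> U" "v \<in> A - U" "R u v"
    by (rule linked_edge[OF assms(1)])
  then show "\<exists>u\<in>U. \<exists>v\<in>A - U. R' u v" using assms(2) by blast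
qed

section \<open>Degeneracy and resonance in the new frame\<close>

lemma degenerate_relation:
  fixes A :: "('m::finite) elt set"
  assumes A: "is_graph A" and "degenerate A"
  shows "\<exists>n. affine_relation vertex A n \<and> (\<exists>h\<in>A. n h \<noteq> 0)"
proof -
  define f :: "'m elt \<Rightarrow> real^'m" where "f h = (\<chi> i. real_of_int (fst h $ i))" for h
  have finA: "finite A" and sub: "A \<subseteq> G_minus_2" using A by (auto simp: is_graph_def)
  have inj: "inj_on f A"
  proof (rule inj_onI)
    fix h k assume hk: "h \<in> A" "k \<in> A" "f h = f k"
    then have fst: "fst h = fst k" by (simp add: f_def vec_eq_iff)
    moreover have "h \<in> G_minus_2" "k \<in> G_minus_2" using hk sub by auto
    ultimately have "snd h = snd k" by (auto simp: G_minus_2_def)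
    with fst show "h = k" by (simp add: prod_eq_iff)
  qed
  have "affine_dependent (f ` A)"
  proof (rule ccontr)
    assume "\<not> affine_dependent (f ` A)"
    then have "int (card (f ` A)) = aff_dim (f ` A) + 1" by (rule aff_dim_affine_independent)
    moreover have "aff_dim (f ` A) < int (card A) - 1"
      using \<open>degenerate A\<close> unfolding degenerate_def f_def .
    ultimately show False unfolding card_image[OF inj] by linarith
  qed
  then obtain U where U: "sum U (f ` A) = 0" "\<exists>v\<in>f ` A. U v \<noteq> 0" "(\<Sum>v\<in>f ` A. U v *\<^sub>R v) = 0"
    using affine_dependent_explicit_finite[of "f ` A"] finA by blast
  define m where "m h = U (f h)" for h
  have m0: "(\<Sum>h\<in>A. m h) = 0" using U(1) by (simp add: sum.reindex[OF inj] m_def)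
  have "(\<Sum>h\<in>A. m h *\<^sub>R f h) = 0" using U(3) by (simp add: sum.reindex[OF inj] m_def)
  then have "(\<Sum>h\<in>A. m h *\<^sub>R f h) $ i = 0" for i by (simp only: zero_index)
  then have m1: "(\<Sum>h\<in>A. m h * fst h $ i) = 0" for i by (simp add: f_def)
  \<comment> \<open>Taking masses in the relation shows that the coefficients of the red vertices
    sum to zero.\<close>
  have red: "(\<Sum>h\<in>A. m h * (if snd h = Black then 0 else - 2)) = 0"
  proof -
    have "(\<Sum>h\<in>A. m h * (if snd h = Black then 0 else - 2)) = (\<Sum>h\<in>A. m h * (\<Sum>i\<in>UNIV. fst h $ i))"
    proof (rule sum.cong)
      fix h assume "h \<in> A"
      then have "real_of_int (\<Sum>i\<in>UNIV. fst h $ i) = (if snd h = Black then 0 else - 2)"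
        using sub by (auto simp: G_minus_2_def \<eta>_def simp del: of_int_sum)
      then show "m h * (if snd h = Black then 0 else - 2) = m h * (\<Sum>i\<in>UNIV. fst h $ i)" by simp
    qed simp
    also have "\<dots> = (\<Sum>i\<in>UNIV. \<Sum>h\<in>A. m h * fst h $ i)"
      by (simp add: sum_distrib_left) (rule sum.swap)
    finally show ?thesis using m1 by simp
  qed
  \<comment> \<open>The colour sign moves to the coefficients; by \<open>red\<close> their sum
    remains zero.\<close>
  define n where "n h = sign (snd h) * m h" for h :: "'m elt"
  have "(\<Sum>h\<in>A. n h) = (\<Sum>h\<in>A. m h + m h * (if snd h = Black then 0 else - 2))"
  proof (rule sum.cong)
    fix h show "n h = m h + m h * (if snd h = Black then 0 else - 2)"
      by (cases "snd h") (auto simp: n_def)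
  qed simp
  then have "(\<Sum>h\<in>A. n h) = 0" using m0 red by (simp only: sum.distrib)
  moreover have "(\<Sum>h\<in>A. n h * vertex h i) = 0" for i
  proof -
    have "n h * vertex h i = m h * fst h $ i" for h
      by (cases "snd h") (auto simp: n_def vertex_def)
    then show ?thesis using m1 by simp
  qed
  moreover have "\<exists>h\<in>A. n h \<noteq> 0"
  proof -
    obtain h where "h \<in> A" "m h \<noteq> 0" using U(2) by (auto simp: m_def)
    moreover have "n h \<noteq> 0" using \<open>m h \<noteq> 0\<close> by (cases "snd h") (auto simp: n_def)
    ultimately show ?thesis by blast
  qed
  ultimately show ?thesis by (auto simp: affine_relation_def)
qed

text \<open>The sum is the mixed coefficient of the resonance identity for the coefficients
  \<open>n h * sign (snd h)\<close>. These may be real, so \<open>integral_relations_suffice\<close>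
  is applied.\<close>

lemma resonant_orthogonal:
  fixes A :: "('m::finite) elt set"
  assumes A: "is_graph A" and res: "degenerate_resonant A"
    and n: "affine_relation vertex A n" and ij: "i \<noteq> j"
  shows "(\<Sum>h\<in>A. n h * vertex h i * vertex h j) = 0"
proof -
  define m where "m h = n h * sign (snd h)" for h :: "'m elt"
  have finA: "finite A" using A by (simp add: is_graph_def)
  let ?c = "\<lambda>h :: 'm elt. sign (snd h) * of_int (fst h $ i * fst h $ j) :: rat"
  have "(\<Sum>h\<in>A. m h * of_rat (?c h)) = 0"
  proof (rule integral_relations_suffice[OF finA])
    fix r :: "'m elt \<Rightarrow> int"
    assume r: "\<And>k. (\<Sum>h\<in>A. r h * fst h $ k) = 0"
    then have "(\<Sum>h\<in>A. r h *s fst h) = 0" by (simp add: vec_eq_iff)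
    then have "(\<Sum>h\<in>A. of_int (r h) * C h) = 0"
      using res by (simp add: degenerate_resonant_def)
    then have "Poly_Mapping.lookup (\<Sum>h\<in>A. of_int (r h) * C h)
        (Poly_Mapping.single i 1 + Poly_Mapping.single j 1) = 0"
      by (simp only: lookup_zero)
    moreover have "Poly_Mapping.lookup (of_int (r h) * C h) (Poly_Mapping.single i 1 + Poly_Mapping.single j 1)
        = of_int (r h) * ?c h" for h
      using lookup_C[OF ij, of "fst h" "snd h"] by (simp add: lookup_of_int_times)
    ultimately show "(\<Sum>h\<in>A. of_int (r h) * ?c h) = 0" by (simp only: lookup_sum)
  next
    fix k
    have "m h * fst h $ k = n h * vertex h k" for h
      by (cases "snd h") (auto simp: m_def vertex_def)
    then show "(\<Sum>h\<in>A. m h * fst h $ k) = 0" using n by (simp add: affine_relation_def)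
  qed
  moreover have "m h * of_rat (?c h) = n h * vertex h i * vertex h j" for h
    by (cases "snd h") (auto simp: m_def vertex_def of_rat_mult of_rat_minus)
  ultimately show ?thesis by simp
qed

lemma exists_opposite_pair:
  assumes A: "is_graph A" and res: "degenerate_resonant A"
  shows "\<exists>a b i. (a, Black) \<in> A \<and> (b, Red) \<in> A \<and> a + b = (- 2) *s e i"
proof -
  have finA: "finite A" and sub: "A \<subseteq> G_minus_2" using A by (auto simp: is_graph_def)
  have "degenerate A" using res by (simp add: degenerate_resonant_def)
  then obtain n where n: "affine_relation vertex A n" "\<exists>h\<in>A. n h \<noteq> 0"
    using degenerate_relation[OF A] by blast
  have "\<exists>u\<in>A. \<exists>v\<in>A. \<exists>k. vertex u k - vertex v k = 2 \<and> (\<forall>l. l \<noteq> k \<longrightarrow> vertex u l = vertex v l)"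
  proof (rule resonant_configuration_has_double_step[OF finA _ _ _ n])
    show "inj_on vertex A" using vertex_inj sub by (rule inj_on_subset)
    show "linked (step vertex) A" using is_graph_linked[OF A] adjacent_step by (rule linked_mono)
    show "even (\<Sum>k\<in>UNIV. vertex u k - vertex v k)" if "u \<in> A" "v \<in> A" for u v
      using that sub by (simp add: sum_subtractf sum_vertex subsetD)
  qed (rule resonant_orthogonal[OF A res])
  then obtain u v k where uv: "u \<in> A" "v \<in> A" and k: "vertex u k - vertex v k = 2"
    and other: "\<And>l. l \<noteq> k \<Longrightarrow> vertex u l = vertex v l" by blast
  \<comment> \<open>The masses differ by 2, so \<open>u\<close> is red and \<open>v\<close> is
    black.\<close>
  have "(\<Sum>l\<in>UNIV. vertex u l) - (\<Sum>l\<in>UNIV. vertex v l) = (\<Sum>l\<in>UNIV. if l = k then 2 else 0)"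
    unfolding sum_subtractf[symmetric] using k other by (intro sum.cong) auto
  moreover have "u \<in> G_minus_2" "v \<in> G_minus_2" using uv sub by auto
  ultimately have col: "snd u = Red" "snd v = Black"
    by (cases "snd u"; cases "snd v"; simp add: sum_vertex)+
  then have "(fst v, Black) \<in> A" "(fst u, Red) \<in> A" using uv by (metis prod.collapse)+
  moreover have "fst v + fst u = (- 2) *s e k"
  proof -
    have "fst v $ l + fst u $ l = - 2 * of_bool (l = k)" for l
      using k other[of l] col by (cases "l = k") (auto simp: vertex_def)
    then show ?thesis by (auto simp: vec_eq_iff e_def axis_def)
  qed
  ultimately show ?thesis by blast
qed

section \<open>Generic configurations\<close>

lemma \<pi>_add: "\<pi> v (a + b) = \<pi> v a + \<pi> v b"
  by (simp add: \<pi>_def sum.distrib scaleR_add_left)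

lemma \<pi>_minus: "\<pi> v (- a) = - \<pi> v a"
  by (simp add: \<pi>_def sum_negf)

lemma \<pi>_diff: "\<pi> v (a - b) = \<pi> v a - \<pi> v b"
  using \<pi>_add[of v a "- b"] by (simp add: \<pi>_minus)

lemma \<pi>_e: "\<pi> v (e i) = v $ i"
proof -
  have "\<pi> v (e i) = (\<Sum>j\<in>UNIV. if j = i then v $ i else 0)"
    unfolding \<pi>_def by (intro sum.cong) (auto simp: e_def axis_def)
  then show ?thesis by simp
qed

definition squares :: "real ^ 'n ^ 'm \<Rightarrow> int ^ ('m::finite) \<Rightarrow> real" where
  "squares v a = (\<Sum>i\<in>UNIV. of_int (a $ i) * (norm (v $ i))\<^sup>2)"

lemma squares_add: "squares v (a + b) = squares v a + squares v b"
  by (simp add: squares_def sum.distrib distrib_right)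

lemma squares_minus: "squares v (- a) = - squares v a"
  by (simp add: squares_def sum_negf)

lemma squares_diff: "squares v (a - b) = squares v a - squares v b"
  using squares_add[of v a "- b"] by (simp add: squares_minus)

lemma squares_e: "squares v (e i) = (norm (v $ i))\<^sup>2"
proof -
  have "squares v (e i) = (\<Sum>j\<in>UNIV. if j = i then (norm (v $ i))\<^sup>2 else 0)"
    unfolding squares_def by (intro sum.cong) (auto simp: e_def axis_def)
  then show ?thesis by simp
qed

lemma K_eq: "K v (a, s) = sign s / 2 * ((norm (\<pi> v a))\<^sup>2 + squares v a)"
  by (simp add: squares_def)

section \<open>Edge equations of a realization\<close>

lemmas inner_expand = power2_norm_eq_inner inner_add_left inner_add_right inner_diff_left
  inner_diff_right inner_minus_left inner_minus_right

text \<open>Subtracting the equations removes \<open>r\<close>, which is 0 for black vertices and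
  the squared norm of \<open>x\<close> for red ones. What remains is the black edge condition at
  \<open>\<epsilon> *\<^sub>R x - p\<close>.\<close>

lemma black_edge:
  fixes x p u w :: "'a::real_inner" and \<epsilon> r q :: real
  assumes "\<epsilon> = 1 \<or> \<epsilon> = - 1"
    and "r + x \<bullet> p = \<epsilon> / 2 * ((norm p)\<^sup>2 + q)"
    and "r + x \<bullet> (u - w + p) = \<epsilon> / 2 * ((norm (u - w + p))\<^sup>2 + ((norm u)\<^sup>2 - (norm w)\<^sup>2 + q))"
  shows "(\<epsilon> *\<^sub>R x - p - u) \<bullet> (u - w) = 0"
  using assms by (auto simp: inner_expand inner_commute field_simps)

text \<open>Subtracting the first equation from the second eliminates \<open>q\<close>. The case
  \<open>u = w\<close> is allowed and yields \<open>x - p = u\<close>.\<close>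

lemma red_edge:
  fixes x p u w :: "'a::real_inner" and q :: real
  assumes "x \<bullet> p = 1 / 2 * ((norm p)\<^sup>2 + q)"
    and "(norm x)\<^sup>2 + x \<bullet> (- u - w - p)
      = - 1 / 2 * ((norm (- u - w - p))\<^sup>2 + (- (norm u)\<^sup>2 - (norm w)\<^sup>2 - q))"
  shows "(x - p - u) \<bullet> (x - p - w) = 0"
  using assms by (simp add: inner_expand inner_commute field_simps)

lemma red_edge':
  fixes x p u w :: "'a::real_inner" and q :: real
  assumes "(norm x)\<^sup>2 + x \<bullet> p = - 1 / 2 * ((norm p)\<^sup>2 + q)"
    and "x \<bullet> (- u - w - p)
      = 1 / 2 * ((norm (- u - w - p))\<^sup>2 + (- (norm u)\<^sup>2 - (norm w)\<^sup>2 - q))"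
  shows "(- x - p - u) \<bullet> (- x - p - w) = 0"
  using assms by (simp add: inner_expand inner_commute field_simps)

text \<open>The affine action of \<open>G\<close>: a black \<open>a\<close> translates by
  \<open>- \<pi> v a\<close>, and \<tau> is the reflection in the origin.\<close>

definition act :: "real ^ 'n ^ 'm \<Rightarrow> ('m::finite) elt \<Rightarrow> real ^ ('n::finite) \<Rightarrow> real ^ 'n" where
  "act v h x = sign (snd h) *\<^sub>R x - \<pi> v (fst h)"

text \<open>Then no edge leaves the special component.\<close>

definition isolated_special :: "real ^ 'n ^ 'm \<Rightarrow> bool" where
  "isolated_special v \<longleftrightarrow> (\<forall>i j k. i \<noteq> k \<longrightarrow> j \<noteq> k \<longrightarrow> (v $ i - v $ k) \<bullet> (v $ k - v $ j) \<noteq> 0)"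

text \<open>The two equations impose the edge condition at \<open>v $ l\<close>. Genericity makes
  \<open>v $ l\<close> one end of the edge within the special component, so the step leads to the
  other end.\<close>

lemma act_special_step:
  fixes v :: "real ^ ('n::finite) ^ ('m::finite)"
  assumes gen: "isolated_special v" and real: "geometric_realization v A x"
    and h: "h \<in> A" "h' \<in> A" "adjacent h h'" and l: "act v h x = v $ l"
  shows "\<exists>l'. act v h' x = v $ l'"
proof -
  obtain a s where as: "h = (a, s)" by force
  have black: "x \<bullet> \<pi> v b = 1 / 2 * ((norm (\<pi> v b))\<^sup>2 + squares v b)" if "(b, Black) \<in> A" for b
    using real that K_eq[of v b Black] by (simp add: geometric_realization_def)
  have red: "(norm x)\<^sup>2 + x \<bullet> \<pi> v b = - 1 / 2 * ((norm (\<pi> v b))\<^sup>2 + squares v b)" if "(b, Red) \<in> A" for b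
    using real that K_eq[of v b Red] by (simp add: geometric_realization_def)
  obtain z where z: "z \<in> X" "h' = z \<otimes>\<^bsub>G\<^esub> h" using h(3) by (auto simp: adjacent_def)
  then consider i j where "i \<noteq> j" "z = (e i - e j, Black)"
    | i j where "i \<noteq> j" "z = (- e i - e j, Red)" by (auto simp: X_def)
  then show ?thesis
  proof cases
    case 1
    have h': "h' = (e i - e j + a, s)" by (cases s) (auto simp: z(2) 1 as G_def)
    have "(sign s *\<^sub>R x - \<pi> v a - v $ i) \<bullet> (v $ i - v $ j) = 0"
    proof (cases s)
      case Black
      show ?thesis
        using black[of a] black[of "e i - e j + a"] h unfolding h' as Black
        by (intro black_edge[of _ 0 _ _ "squares v a"])
          (auto simp: \<pi>_add \<pi>_diff \<pi>_e squares_add squares_diff squares_e)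
    next
      case Red
      show ?thesis
        using red[of a] red[of "e i - e j + a"] h unfolding h' as Red
        by (intro black_edge[of _ "(norm x)\<^sup>2" _ _ "squares v a"])
          (auto simp: \<pi>_add \<pi>_diff \<pi>_e squares_add squares_diff squares_e)
    qed
    then have "(v $ l - v $ i) \<bullet> (v $ i - v $ j) = 0" using l by (simp add: act_def as)
    then have "l = i" using gen 1(1) unfolding isolated_special_def by metis
    then have "act v h' x = v $ j"
      using l by (simp add: act_def as h' \<pi>_add \<pi>_diff \<pi>_e algebra_simps)
    then show ?thesis by blast
  next
    case 2
    define s' where "s' = (if s = Black then Red else Black)"
    have h': "h' = (- e i - e j - a, s')" by (cases s) (auto simp: z(2) 2 as G_def s'_def vec_eq_iff)
    have "(sign s *\<^sub>R x - \<pi> v a - v $ i) \<bullet> (sign s *\<^sub>R x - \<pi> v a - v $ j) = 0"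
    proof (cases s)
      case Black
      have "(x - \<pi> v a - v $ i) \<bullet> (x - \<pi> v a - v $ j) = 0"
        using black[of a] red[of "- e i - e j - a"] h unfolding h' as s'_def Black
        by (intro red_edge[of _ _ "squares v a"])
          (auto simp: \<pi>_minus \<pi>_diff \<pi>_e squares_minus squares_diff squares_e)
      then show ?thesis by (simp add: Black)
    next
      case Red
      have "(- x - \<pi> v a - v $ i) \<bullet> (- x - \<pi> v a - v $ j) = 0"
        using red[of a] black[of "- e i - e j - a"] h unfolding h' as s'_def Red
        by (intro red_edge'[of _ _ "squares v a"])
          (auto simp: \<pi>_minus \<pi>_diff \<pi>_e squares_minus squares_diff squares_e)
      then show ?thesis by (simp add: Red)
    qed
    then have "(v $ l - v $ i) \<bullet> (v $ l - v $ j) = 0" using l by (simp add: act_def as)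
    then have "(v $ i - v $ l) \<bullet> (v $ l - v $ j) = 0"
      by (metis inner_minus_left minus_diff_eq neg_equal_0_iff_equal)
    then have "i = l \<or> j = l" using gen unfolding isolated_special_def by metis
    moreover have "act v h' x = v $ i + v $ j - v $ l"
      unfolding l[symmetric]
      by (cases s) (simp_all add: act_def as h' s'_def \<pi>_add \<pi>_diff \<pi>_minus \<pi>_e algebra_simps)
    ultimately have "act v h' x = v $ j \<or> act v h' x = v $ i" by auto
    then show ?thesis by blast
  qed
qed

lemma no_realization_outside_special:
  fixes v :: "real ^ ('n::finite) ^ ('m::finite)"
  assumes A: "is_graph A" and gen: "isolated_special v" and real: "geometric_realization v A x"
    and ab: "(a, Black) \<in> A" "(b, Red) \<in> A" "a + b = (- 2) *s e i"
  shows "x \<in> range (\<lambda>i. v $ i)"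
proof -
  define U where "U = {h \<in> A. \<exists>l. act v h x = v $ l}"
  have b: "b = - e i - e i - a"
    using ab(3) by (simp add: vec_eq_iff) (metis add_diff_cancel_left')
  have 1: "x \<bullet> \<pi> v a = 1 / 2 * ((norm (\<pi> v a))\<^sup>2 + squares v a)"
    using real ab(1) K_eq[of v a Black] by (simp add: geometric_realization_def)
  have "(norm x)\<^sup>2 + x \<bullet> \<pi> v b = - 1 / 2 * ((norm (\<pi> v b))\<^sup>2 + squares v b)"
    using real ab(2) K_eq[of v b Red] by (simp add: geometric_realization_def)
  \<comment> \<open>The opposite pair acts as a red edge with both indices equal to
    \<open>i\<close>, so this squared distance vanishes.\<close>
  then have "(x - \<pi> v a - v $ i) \<bullet> (x - \<pi> v a - v $ i) = 0"
    unfolding b \<pi>_diff \<pi>_minus \<pi>_e squares_diff squares_minus squares_e by (rule red_edge[OF 1])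
  then have "act v (a, Black) x = v $ i" by (simp add: act_def)
  then have aU: "(a, Black) \<in> U" using ab by (auto simp: U_def)
  have "U = A"
  proof (rule ccontr)
    assume ne: "U \<noteq> A"
    have sub: "U \<subseteq> A" "U \<noteq> {}" using aU by (auto simp: U_def)
    obtain h h' where "h \<in> U" "h' \<in> A - U" "adjacent h h'"
      by (rule linked_edge[OF is_graph_linked[OF A] sub ne])
    then show False using act_special_step[OF gen real, of h h'] by (auto simp: U_def)
  qed
  moreover have "(0, Black) \<in> A" using A by (simp add: is_graph_def)
  ultimately obtain l where "act v (0, Black) x = v $ l" by (auto simp: U_def)
  then have "x = v $ l" by (simp add: act_def \<pi>_def)
  then show ?thesis by blast
qed

lemma generic_isolated_special: "for_generic (isolated_special :: real ^ ('n::finite) ^ ('m::finite) \<Rightarrow> bool)"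
proof -
  define T :: "('m \<times> 'm \<times> 'm) set" where "T = {(i, j, k). i \<noteq> k \<and> j \<noteq> k}"
  define F :: "real ^ 'n ^ 'm \<Rightarrow> real"
    where "F v = (\<Prod>(i, j, k)\<in>T. (v $ i - v $ k) \<bullet> (v $ k - v $ j))" for v
  have coord: "real_polynomial_function (\<lambda>v :: real ^ 'n ^ 'm. v $ i $ l)" for i l
    by (intro real_polynomial_function.intros(1) bounded_linear_compose[OF bounded_linear_vec_nth bounded_linear_vec_nth])
  have "real_polynomial_function F"
    unfolding F_def inner_vec_def
    by (intro real_polynomial_function_prod) (auto simp: T_def intro!: real_polynomial_function_sum
        real_polynomial_function.intros(4) real_polynomial_function_diff coord)
  moreover have "\<exists>w. F w \<noteq> 0"
  proof -
    \<comment> \<open>Distinct points on one line: every factor is then a product of nonzero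
      numbers.\<close>
    define w :: "real ^ 'n ^ 'm" where "w = (\<chi> i l. real (to_nat i))"
    have "(w $ i - w $ k) \<bullet> (w $ k - w $ j)
        = real CARD('n) * (real (to_nat i) - real (to_nat k)) * (real (to_nat k) - real (to_nat j))" for i j k
      by (simp add: w_def inner_vec_def)
    then have "F w \<noteq> 0" by (auto simp: F_def T_def)
    then show ?thesis by blast
  qed
  moreover have "isolated_special v" if "F v \<noteq> 0" for v
    using that by (auto simp: F_def isolated_special_def T_def)
  ultimately show ?thesis unfolding for_generic_def by blast
qed

theorem theorem4:
  fixes A :: "('m::finite) elt set"
  assumes "is_graph A" and "degenerate_resonant A"
  shows "\<not> allowable A \<and>
    for_generic (\<lambda>v :: real ^ ('n::finite) ^ 'm.
      \<not> (\<exists>x. x \<notin> range (\<lambda>i. v $ i) \<and> geometric_realization v A x))"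
proof
  obtain a b i where ab: "(a, Black) \<in> A" "(b, Red) \<in> A" "a + b = (- 2) *s e i"
    using exists_opposite_pair[OF assms] by blast
  then show "\<not> allowable A" unfolding allowable_def by blast
  obtain F :: "real ^ 'n ^ 'm \<Rightarrow> real" where F: "real_polynomial_function F" "\<exists>w. F w \<noteq> 0"
    "\<And>v. F v \<noteq> 0 \<Longrightarrow> isolated_special v"
    using generic_isolated_special unfolding for_generic_def by blast
  show "for_generic (\<lambda>v :: real ^ 'n ^ 'm.
      \<not> (\<exists>x. x \<notin> range (\<lambda>i. v $ i) \<and> geometric_realization v A x))"
    unfolding for_generic_def
    using F no_realization_outside_special[OF assms(1) _ _ ab] by blast
qed

end
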